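(* Let $R$ be a characteristic range set, let $X$ be an ultrametrizable topological space, and let $n\geq 1$ be an integer. If the space $(\mathrm{UMet}_{\mathrm{bd}}(X;R),\mathcal{UD}_X^R)$ belongs to the absolute Borel class $\mathfrak{M}_n$, then $X$ belongs to the absolute Borel class $\mathfrak{A}_n$.
   Context: A range set is a subset $R\subseteq[0,\infty)$ with $0\in R$; it is characteristic if $\inf(R\setminus\{0\})=0$. A pseudo-ultrametric on a set $X$ is a symmetric map $d\colon X\times X\to[0,\infty)$ vanishing on the diagonal with $d(x,y)\leq d(x,z)\vee d(z,y)$ for all $x,y,z$, where $a\vee b=\max\{a,b\}$; it is an ultrametric if moreover $d(x,y)=0$ implies $x=y$. It is $R$-valued if all its values lie in $R$. A topological space is ultrametrizable if its topology is generated by some ultrametric. For a topological space $X$, $\mathrm{UMet}_{\mathrm{bd}}(X;R)$ denotes the set of all bounded $R$-valued ultrametrics on $X$ that generate the topology of $X$. For $R$-valued pseudo-ultrametrics $d,e$ on $X$, $$\mathcal{UD}_X^R(d,e)=\inf\bigl\{\epsilon\in R\setminus\{0\} : d(x,y)\leq e(x,y)\vee\epsilon\ \text{and}\ e(x,y)\leq d(x,y)\vee\epsilon\ \text{for all } x,y\in X\bigr\},$$ with $\inf\emptyset=\infty$. This is an extended ultrametric (values in $[0,\infty]$), and $\mathrm{UMet}_{\mathrm{bd}}(X;R)$ is given the metrizable topology generated by its $\epsilon$-balls. Absolute Borel classes: for a metrizable space $Y$, $\mathfrak{A}_0(Y)$ and $\mathfrak{M}_0(Y)$ are the families of open and closed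 subsets of $Y$, respectively. For $n\geq1$, $\mathfrak{A}_n(Y)$ consists of the countable unions of sets in $\bigcup_{m<n}\mathfrak{M}_m(Y)$, and $\mathfrak{M}_n(Y)$ consists of the countable intersections of sets in $\bigcup_{m<n}\mathfrak{A}_m(Y)$. A metrizable space $T$ belongs to the absolute class $\mathfrak{A}_n$ (respectively $\mathfrak{M}_n$) if $T\in\mathfrak{A}_n(Y)$ (respectively $T\in\mathfrak{M}_n(Y)$) for every metrizable space $Y$ containing $T$ as a subspace. *)

theory Defs
  imports "HOL-Analysis.Analysis"
begin

section \<open>Range sets and ultrametrics\<close>

definition range_set :: "real set \<Rightarrow> bool" where
  "range_set R \<longleftrightarrow> R \<subseteq> {0..} \<and> 0 \<in> R"

text \<open>The infimum is taken in the extended reals, so that \<open>R = {0}\<close> is not characteristic.\<close>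

definition characteristic :: "real set \<Rightarrow> bool" where
  "characteristic R \<longleftrightarrow> Inf (ereal ` (R - {0})) = 0"

text \<open>
  A map on \<open>M \<times> M\<close> is represented by a total function that is zero off \<open>M \<times> M\<close>.
  This makes the representation unique (so that sets of such functions are sets of maps on
  \<open>M \<times> M\<close>), and an ultrametric on \<open>M\<close> then satisfies the library predicate \<open>Metric_space M\<close>.
\<close>

definition pseudo_ultrametric_on :: "'a set \<Rightarrow> ('a \<Rightarrow> 'a \<Rightarrow> real) \<Rightarrow> bool" where
  "pseudo_ultrametric_on M d \<longleftrightarrow>
     (\<forall>x\<in>M. \<forall>y\<in>M. 0 \<le> d x y) \<and>
     (\<forall>x\<in>M. d x x = 0) \<and>
     (\<forall>x\<in>M. \<forall>y\<in>M. d x y = d y x) \<and>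
     (\<forall>x\<in>M. \<forall>y\<in>M. \<forall>z\<in>M. d x y \<le> max (d x z) (d z y)) \<and>
     (\<forall>x y. x \<notin> M \<or> y \<notin> M \<longrightarrow> d x y = 0)"

definition ultrametric_on :: "'a set \<Rightarrow> ('a \<Rightarrow> 'a \<Rightarrow> real) \<Rightarrow> bool" where
  "ultrametric_on M d \<longleftrightarrow>
     pseudo_ultrametric_on M d \<and> (\<forall>x\<in>M. \<forall>y\<in>M. d x y = 0 \<longrightarrow> x = y)"

lemma ultrametric_on_imp_Metric_space:
  assumes "ultrametric_on M d"
  shows "Metric_space M d"
proof
  show "0 \<le> d x y" for x y
    using assms unfolding ultrametric_on_def pseudo_ultrametric_on_def
    by (cases "x \<in> M \<and> y \<in> M") auto
  show "d x y = d y x" for x y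
    using assms unfolding ultrametric_on_def pseudo_ultrametric_on_def
    by (cases "x \<in> M \<and> y \<in> M") auto
  show "d x y = 0 \<longleftrightarrow> x = y" if "x \<in> M" "y \<in> M" for x y
    using assms that unfolding ultrametric_on_def pseudo_ultrametric_on_def by auto
  show "d x z \<le> d x y + d y z" if "x \<in> M" "y \<in> M" "z \<in> M" for x y z
  proof -
    have "d x z \<le> max (d x y) (d y z)" "0 \<le> d x y" "0 \<le> d y z"
      using assms that unfolding ultrametric_on_def pseudo_ultrametric_on_def by auto
    then show ?thesis by linarith
  qed
qed

definition ultrametrizable_space :: "'a topology \<Rightarrow> bool" where
  "ultrametrizable_space X \<longleftrightarrow>
     (\<exists>d. ultrametric_on (topspace X) d \<and> Metric_space.mtopology (topspace X) d = X)"


section \<open>The space of bounded \<open>R\<close>-valued ultrametrics\<close>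

definition UMet_bd :: "'a topology \<Rightarrow> real set \<Rightarrow> ('a \<Rightarrow> 'a \<Rightarrow> real) set" where
  "UMet_bd X R =
     {d. ultrametric_on (topspace X) d \<and>
         (\<forall>x\<in>topspace X. \<forall>y\<in>topspace X. d x y \<in> R) \<and>
         (\<exists>B. \<forall>x\<in>topspace X. \<forall>y\<in>topspace X. d x y \<le> B) \<and>
         Metric_space.mtopology (topspace X) d = X}"

definition UD :: "'a set \<Rightarrow> real set \<Rightarrow> ('a \<Rightarrow> 'a \<Rightarrow> real) \<Rightarrow> ('a \<Rightarrow> 'a \<Rightarrow> real) \<Rightarrow> ereal" where
  "UD M R d e =
     Inf (ereal ` {\<epsilon> \<in> R - {0}. \<forall>x\<in>M. \<forall>y\<in>M.
            d x y \<le> max (e x y) \<epsilon> \<and> e x y \<le> max (d x y) \<epsilon>})"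

definition UMet_bd_space :: "'a topology \<Rightarrow> real set \<Rightarrow> ('a \<Rightarrow> 'a \<Rightarrow> real) topology" where
  "UMet_bd_space X R =
     topology_generated_by
       {{e \<in> UMet_bd X R. UD (topspace X) R d e < ereal \<epsilon>} | d \<epsilon>. d \<in> UMet_bd X R \<and> 0 < \<epsilon>}"


section \<open>Borel classes\<close>

text \<open>The condition \<open>\<C> \<noteq> {}\<close> is needed because \<open>\<Inter>{}\<close> is \<open>UNIV\<close> and not \<open>topspace Y\<close>.\<close>

fun additive_class :: "'y topology \<Rightarrow> nat \<Rightarrow> 'y set set"
  and multiplicative_class :: "'y topology \<Rightarrow> nat \<Rightarrow> 'y set set" where
  "additive_class Y 0 = {U. openin Y U}"
| "additive_class Y (Suc n) =
     {\<Union>\<C> | \<C>. countable \<C> \<and> \<C> \<subseteq> (\<Union>m\<in>{..<Suc n}. multiplicative_class Y m)}"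
| "multiplicative_class Y 0 = {C. closedin Y C}"
| "multiplicative_class Y (Suc n) =
     {\<Inter>\<C> | \<C>. countable \<C> \<and> \<C> \<noteq> {} \<and> \<C> \<subseteq> (\<Union>m\<in>{..<Suc n}. additive_class Y m)}"

text \<open>
  HOL cannot quantify over the types that carry the ambient spaces \<open>Y\<close>, so the carrier type
  is a parameter, and containing \<open>T\<close> as a subspace means having a topological embedding of \<open>T\<close>.
  The lemmas \<open>absolute_multiplicative_universal\<close> and \<open>absolute_additive_universal\<close> below show
  that for \<open>T :: 't topology\<close> the carrier type \<open>nat \<Rightarrow> 't\<close> already accounts for the ambient
  spaces over all types: a metrizable space in which \<open>T\<close> is dense is in bijection with a set of
  sequences in \<open>T\<close>.
\<close>

definition absolute_additive :: "'y itself \<Rightarrow> nat \<Rightarrow> 't topology \<Rightarrow> bool" where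
  "absolute_additive _ n T \<longleftrightarrow>
     metrizable_space T \<and>
     (\<forall>(Y :: 'y topology) f. metrizable_space Y \<and> embedding_map T Y f \<longrightarrow>
        f ` topspace T \<in> additive_class Y n)"

definition absolute_multiplicative :: "'y itself \<Rightarrow> nat \<Rightarrow> 't topology \<Rightarrow> bool" where
  "absolute_multiplicative _ n T \<longleftrightarrow>
     metrizable_space T \<and>
     (\<forall>(Y :: 'y topology) f. metrizable_space Y \<and> embedding_map T Y f \<longrightarrow>
        f ` topspace T \<in> multiplicative_class Y n)"


section \<open>Independence of the carrier type\<close>

lemma Borel_class_subset:
  "(\<forall>S \<in> additive_class Y n. S \<subseteq> topspace Y) \<and> (\<forall>S \<in> multiplicative_class Y n. S \<subseteq> topspace Y)"
proof (induction n rule: less_induct)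
  case (less n)
  show ?case
  proof (cases n)
    case 0
    then show ?thesis by (auto dest: openin_subset closedin_subset)
  next
    case (Suc k)
    show ?thesis
    proof (intro conjI ballI)
      fix S assume "S \<in> additive_class Y n"
      then obtain \<C> where C: "S = \<Union>\<C>" "\<C> \<subseteq> (\<Union>m\<in>{..<n}. multiplicative_class Y m)"
        using Suc by auto
      have "C \<subseteq> topspace Y" if "C \<in> \<C>" for C
        using C(2) that less.IH by blast
      then show "S \<subseteq> topspace Y" using C(1) by blast
    next
      fix S assume "S \<in> multiplicative_class Y n"
      then obtain \<C> where C: "S = \<Inter>\<C>" "\<C> \<noteq> {}" "\<C> \<subseteq> (\<Union>m\<in>{..<n}. additive_class Y m)"
        using Suc by auto
      have "C \<subseteq> topspace Y" if "C \<in> \<C>" for C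
        using C(3) that less.IH by blast
      then show "S \<subseteq> topspace Y" using C(1,2) by blast
    qed
  qed
qed

lemma Borel_class_vimage:
  assumes "continuous_map Y Z g"
  shows "(\<forall>S \<in> additive_class Z n. {y \<in> topspace Y. g y \<in> S} \<in> additive_class Y n) \<and>
         (\<forall>S \<in> multiplicative_class Z n. {y \<in> topspace Y. g y \<in> S} \<in> multiplicative_class Y n)"
proof (induction n rule: less_induct)
  case (less n)
  show ?case
  proof (cases n)
    case 0
    then show ?thesis
      using assms by (auto intro: openin_continuous_map_preimage closedin_continuous_map_preimage)
  next
    case (Suc k)
    let ?p = "\<lambda>S. {y \<in> topspace Y. g y \<in> S}"
    show ?thesis
    proof (intro conjI ballI)
      fix S assume "S \<in> additive_class Z n"
      then obtain \<C> where C: "S = \<Union>\<C>" "countable \<C>"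
          "\<C> \<subseteq> (\<Union>m\<in>{..<n}. multiplicative_class Z m)"
        using Suc by auto
      have "?p C \<in> (\<Union>m\<in>{..<n}. multiplicative_class Y m)" if "C \<in> \<C>" for C
        using C(3) that less.IH by blast
      then have "?p ` \<C> \<subseteq> (\<Union>m\<in>{..<n}. multiplicative_class Y m)" by blast
      moreover have "countable (?p ` \<C>)" "?p S = \<Union>(?p ` \<C>)" using C by auto
      ultimately show "?p S \<in> additive_class Y n" 
        unfolding Suc additive_class.simps by blast
    next
      fix S assume "S \<in> multiplicative_class Z n"
      then obtain \<C> where C: "S = \<Inter>\<C>" "countable \<C>" "\<C> \<noteq> {}"
          "\<C> \<subseteq> (\<Union>m\<in>{..<n}. additive_class Z m)"
        using Suc by auto
      have "?p C \<in> (\<Union>m\<in>{..<n}. additive_class Y m)" if "C \<in> \<C>" for C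
        using C(4) that less.IH by blast
      then have "?p ` \<C> \<subseteq> (\<Union>m\<in>{..<n}. additive_class Y m)" by blast
      moreover have "countable (?p ` \<C>)" "?p ` \<C> \<noteq> {}" "?p S = \<Inter>(?p ` \<C>)" using C by auto
      ultimately show "?p S \<in> multiplicative_class Y n" 
        unfolding Suc multiplicative_class.simps by blast
    qed
  qed
qed

lemma Borel_class_closed_subspace:
  assumes Y: "metrizable_space Y" and K: "closedin Y K"
  shows "(n > 0 \<longrightarrow> (\<forall>S \<in> additive_class (subtopology Y K) n. S \<in> additive_class Y n)) \<and>
         (\<forall>S \<in> multiplicative_class (subtopology Y K) n. S \<in> multiplicative_class Y n)"
proof (induction n rule: less_induct)
  case (less n)
  have traceA: "\<exists>S'. S' \<in> additive_class Y m \<and> S = S' \<inter> K"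
    if "S \<in> additive_class (subtopology Y K) m" "m < n" for S m
  proof (cases m)
    case 0
    then show ?thesis using that by (auto simp: openin_subtopology)
  next
    case (Suc k)
    then have "S \<in> additive_class Y m" using less.IH[OF that(2)] that(1) by blast
    moreover have "S \<subseteq> K"
      using Borel_class_subset[of "subtopology Y K" m] that(1) by (auto simp: topspace_subtopology)
    ultimately show ?thesis by blast
  qed
  show ?case
  proof (cases n)
    case 0
    then show ?thesis using K by (auto simp: closedin_closed_subtopology)
  next
    case (Suc k)
    show ?thesis
    proof (intro conjI ballI impI)
      fix S assume "S \<in> additive_class (subtopology Y K) n"
      then obtain \<C> where C: "S = \<Union>\<C>" "countable \<C>"
          "\<C> \<subseteq> (\<Union>m\<in>{..<n}. multiplicative_class (subtopology Y K) m)"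
        using Suc by auto
      have "\<C> \<subseteq> (\<Union>m\<in>{..<n}. multiplicative_class Y m)"
        using C(3) less.IH by blast
      then show "S \<in> additive_class Y n"
        unfolding Suc additive_class.simps using C(1,2) by blast
    next
      fix S assume "S \<in> multiplicative_class (subtopology Y K) n"
      then obtain \<C> where C: "S = \<Inter>\<C>" "countable \<C>" "\<C> \<noteq> {}"
          "\<C> \<subseteq> (\<Union>m\<in>{..<n}. additive_class (subtopology Y K) m)"
        using Suc by auto
      have "\<exists>C'. C' \<in> (\<Union>m\<in>{..<n}. additive_class Y m) \<and> C = C' \<inter> K" if "C \<in> \<C>" for C
        using C(4) that traceA by blast
      then obtain h where h: "\<And>C. C \<in> \<C> \<Longrightarrow> h C \<in> (\<Union>m\<in>{..<n}. additive_class Y m) \<and> C = h C \<inter> K"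
        by metis
      obtain \<D> where D: "countable \<D>" "\<D> \<subseteq> Collect (openin Y)" "\<Inter>\<D> = K"
        using closed_imp_gdelta_in[OF Y K] unfolding gdelta_in_alt intersection_of_def by auto
      have "\<D> \<subseteq> (\<Union>m\<in>{..<n}. additive_class Y m)"
        using D(2) Suc by (force intro!: exI[of _ 0] bexI[of _ 0])
      then have "h ` \<C> \<union> \<D> \<subseteq> (\<Union>m\<in>{..<n}. additive_class Y m)" using h by blast
      moreover have "countable (h ` \<C> \<union> \<D>)" "h ` \<C> \<union> \<D> \<noteq> {}" using C D by auto
      moreover have "S = \<Inter>(h ` \<C> \<union> \<D>)"
      proof -
        have "S = (\<Inter>C\<in>\<C>. h C \<inter> K)" using C(1) h by auto
        then show ?thesis using C(3) D(3) by auto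
      qed
      ultimately show "S \<in> multiplicative_class Y n"
        unfolding Suc multiplicative_class.simps by blast
    qed
  qed
qed

lemma embedding_dense_model:
  fixes T :: "'t topology" and Y :: "'y topology"
  assumes Y: "metrizable_space Y" and f: "embedding_map T Y f"
  obtains Z :: "(nat \<Rightarrow> 't) topology" and c
  where "metrizable_space Z" "homeomorphic_map (subtopology Y (Y closure_of (f ` topspace T))) Z c"
    "embedding_map T Z (c \<circ> f)"
proof -
  let ?F = "f ` topspace T"
  let ?K = "Y closure_of ?F"
  let ?S = "subtopology Y ?K"
  have F: "?F \<subseteq> topspace Y"
    using f unfolding embedding_map_def
    by (metis homeomorphic_imp_surjective_map inf.bounded_iff subset_refl topspace_subtopology)
  then have FK: "?F \<subseteq> ?K" by (rule closure_of_subset)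
  have tS: "topspace ?S = ?K"
    using closure_of_subset_topspace[of Y ?F] by auto
  obtain M d where "Metric_space M d" and Yd: "Y = Metric_space.mtopology M d"
    using Y unfolding metrizable_space_def by blast
  then interpret Metric_space M d by simp
  have "\<exists>s. range s \<subseteq> topspace T \<and> limitin Y (f \<circ> s) y sequentially" if yK: "y \<in> ?K" for y
  proof -
    obtain \<sigma> :: "nat \<Rightarrow> 'y" where \<sigma>: "range \<sigma> \<subseteq> ?F" "limitin Y \<sigma> y sequentially"
      using yK unfolding Yd closure_of_sequentially by blast
    then have "\<forall>n. \<exists>t. t \<in> topspace T \<and> \<sigma> n = f t" by blast
    then obtain s where s: "\<And>n. s n \<in> topspace T \<and> \<sigma> n = f (s n)" by metis
    then have "\<sigma> = f \<circ> s" by auto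
    then show ?thesis using s \<sigma>(2) by blast
  qed
  then obtain c where c: "\<And>y. y \<in> ?K \<Longrightarrow> limitin Y (f \<circ> c y) y sequentially" by metis
  have inj: "inj_on c ?K"
  proof (rule inj_onI)
    fix x y assume "x \<in> ?K" "y \<in> ?K" "c x = c y"
    then show "x = y"
      using c[of x] c[of y] limitin_Hausdorff_unique[of Y _ x sequentially y]
        metrizable_imp_Hausdorff_space[OF Y] by auto
  qed
  define g where "g = inv_into ?K c"
  have gc: "\<And>y. y \<in> ?K \<Longrightarrow> g (c y) = y" unfolding g_def using inj by simp
  define Z where "Z = pullback_topology (c ` ?K) g ?S"
  have tZ: "topspace Z = c ` ?K"
    unfolding Z_def topspace_pullback_topology tS using gc by auto
  have cont_g: "continuous_map Z ?S g"
    unfolding Z_def using continuous_map_pullback[of ?S ?S id] by simp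
  have cont_c: "continuous_map ?S Z c"
    unfolding continuous_map_def
  proof (intro conjI allI impI)
    show "c \<in> topspace ?S \<rightarrow> topspace Z" using tS tZ by auto
    fix U assume "openin Z U"
    then obtain V where V: "openin ?S V" "U = g -` V \<inter> c ` ?K"
      unfolding Z_def openin_pullback_topology by blast
    have "c x \<in> U \<longleftrightarrow> x \<in> V" if "x \<in> ?K" for x
      unfolding V(2) using gc[OF that] that by simp
    then have "{x \<in> topspace ?S. c x \<in> U} = V"
      using openin_subset[OF V(1)] unfolding tS by blast
    then show "openin ?S {x \<in> topspace ?S. c x \<in> U}" using V(1) by simp
  qed
  have "homeomorphic_maps ?S Z c g"
    unfolding homeomorphic_maps_def using cont_c cont_g gc tS tZ by auto
  then have hc: "homeomorphic_map ?S Z c" using homeomorphic_maps_map by blast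
  have "metrizable_space Z"
    using homeomorphic_metrizable_space[of ?S Z] hc metrizable_space_subtopology[OF Y]
      homeomorphic_map_imp_homeomorphic_space by blast
  moreover have "embedding_map T ?S f"
    using f FK by (simp add: embedding_map_in_subtopology)
  then have "embedding_map T Z (c \<circ> f)"
    using embedding_map_compose hc surjective_embedding_map by blast
  ultimately show ?thesis using hc that by blast
qed

lemma absolute_class_aux:
  fixes T :: "'t topology" and Y :: "'y topology"
  assumes Y: "metrizable_space Y" and f: "embedding_map T Y f"
  shows "absolute_multiplicative TYPE(nat \<Rightarrow> 't) n T \<Longrightarrow> f ` topspace T \<in> multiplicative_class Y n"
    and "absolute_additive TYPE(nat \<Rightarrow> 't) n T \<Longrightarrow> n > 0 \<Longrightarrow> f ` topspace T \<in> additive_class Y n"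
proof -
  let ?F = "f ` topspace T"
  let ?K = "Y closure_of ?F"
  let ?S = "subtopology Y ?K"
  obtain Z :: "(nat \<Rightarrow> 't) topology" and c where Z: "metrizable_space Z"
      "homeomorphic_map ?S Z c" "embedding_map T Z (c \<circ> f)"
    using embedding_dense_model[OF Y f] by blast
  have F: "?F \<subseteq> topspace Y"
    using f unfolding embedding_map_def
    by (metis homeomorphic_imp_surjective_map inf.bounded_iff subset_refl topspace_subtopology)
  then have FS: "?F \<subseteq> topspace ?S"
    using closure_of_subset[OF F] by (auto simp: topspace_subtopology)
  have inj: "inj_on c (topspace ?S)" using Z(2) homeomorphic_imp_injective_map by blast
  have pre: "{y \<in> topspace ?S. c y \<in> (c \<circ> f) ` topspace T} = ?F"
  proof -
    have "{y \<in> topspace ?S. c y \<in> c ` ?F} = ?F"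
      using inj_on_image_mem_iff[OF inj _ FS] FS by blast
    then show ?thesis by (simp add: image_comp)
  qed
  have cont: "continuous_map ?S Z c" using Z(2) homeomorphic_imp_continuous_map by blast
  note v = Borel_class_vimage[OF cont, of n]
  note s = Borel_class_closed_subspace[OF Y closedin_closure_of, of n ?F]
  {
    assume "absolute_multiplicative TYPE(nat \<Rightarrow> 't) n T"
    then have "(c \<circ> f) ` topspace T \<in> multiplicative_class Z n"
      unfolding absolute_multiplicative_def using Z(1,3) by blast
    then have "?F \<in> multiplicative_class ?S n" using v pre by metis
    then show "?F \<in> multiplicative_class Y n" using s by blast
  }
  {
    assume "absolute_additive TYPE(nat \<Rightarrow> 't) n T" "n > 0"
    then have "(c \<circ> f) ` topspace T \<in> additive_class Z n"
      unfolding absolute_additive_def using Z(1,3) by blast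
    then have "?F \<in> additive_class ?S n" using v pre by metis
    then show "?F \<in> additive_class Y n" using s \<open>n > 0\<close> by blast
  }
qed

theorem absolute_multiplicative_universal:
  fixes T :: "'t topology"
  assumes "absolute_multiplicative TYPE(nat \<Rightarrow> 't) n T"
  shows "absolute_multiplicative TYPE('y) n T"
  using assms absolute_class_aux(1) unfolding absolute_multiplicative_def[where 'y='y]
  by (metis absolute_multiplicative_def)

theorem absolute_additive_universal:
  fixes T :: "'t topology"
  assumes "absolute_additive TYPE(nat \<Rightarrow> 't) n T" "n \<ge> 1"
  shows "absolute_additive TYPE('y) n T"
  using assms absolute_class_aux(2) unfolding absolute_additive_def[where 'y='y]
  by (metis absolute_additive_def less_eq_Suc_le One_nat_def)

end

theory Submission
  imports Defs "HOL-Library.Diagonal_Subsequence"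
begin

text \<open>
  If the image of \<open>X\<close> in \<open>Y\<close> is closed there is nothing to prove. Otherwise, take partitions of \<open>X\<close> into
  clopen sets of mesh tending to 0 in \<open>Y\<close> that are locally finite in \<open>Y\<close> (by the paracompactness of \<open>Y\<close>).
  They embed \<open>X\<close> into a Baire space \<open>Z\<close> of sequences of labels, which carries an \<open>R\<close>-valued ultrametric,
  and a sequence in \<open>X\<close> that converges in \<open>Y\<close> to a point outside \<open>X\<close> yields a point \<open>q\<close> of \<open>Z\<close> in the
  closure of \<open>X\<close> but not in \<open>X\<close>. For \<open>p\<close> in \<open>Z\<close> let \<open>d\<^sub>p\<close> be the pseudo-ultrametric that \<open>X\<close> inherits from the
  quotient of \<open>Z\<close> identifying \<open>p\<close> with \<open>q\<close>. It depends continuously on \<open>p\<close>, and it generates the topology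
  of \<open>X\<close> exactly if \<open>p\<close> is not in \<open>X\<close>: otherwise a sequence in \<open>X\<close> tending to \<open>q\<close> converges to \<open>p\<close>.
  So the complement of \<open>X\<close> in \<open>Z\<close> is a continuous preimage of the space of ultrametrics, and \<open>X\<close> is of
  class \<open>A\<^sub>n\<close> in \<open>Z\<close>. This passes to \<open>Y\<close>: for \<open>n = 1\<close> because, by local finiteness, a subset of \<open>X\<close>
  closed in \<open>Z\<close> is closed in \<open>Y\<close>; for \<open>n \<ge> 2\<close> because \<open>X\<close> is the preimage of \<open>X\<close> under a continuous map
  to \<open>Z\<close> from a \<open>G\<^sub>\<delta>\<close> subset of \<open>Y\<close>.
\<close>

section \<open>Borel classes\<close>

lemma Borel_class_complement:
  "(\<forall>S \<in> additive_class Y n. topspace Y - S \<in> multiplicative_class Y n) \<and>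
   (\<forall>S \<in> multiplicative_class Y n. topspace Y - S \<in> additive_class Y n)"
proof (induction n rule: less_induct)
  case (less n)
  show ?case
  proof (cases n)
    case 0
    then show ?thesis by (auto simp: closedin_def openin_subset double_diff)
  next
    case (Suc k)
    show ?thesis
    proof (intro conjI ballI)
      fix S assume "S \<in> additive_class Y n"
      then obtain \<C> where C: "S = \<Union>\<C>" "countable \<C>"
          "\<C> \<subseteq> (\<Union>m\<in>{..<n}. multiplicative_class Y m)"
        using Suc by auto
      \<comment> \<open>The complements alone would not do for empty \<open>\<C>\<close>: the
        intersection must be over a nonempty family, and \<open>topspace Y\<close> makes it
        so.\<close>
      let ?D = "insert (topspace Y) ((\<lambda>C. topspace Y - C) ` \<C>)"
      have "topspace Y \<in> additive_class Y 0" by simp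
      then have "topspace Y \<in> (\<Union>m\<in>{..<n}. additive_class Y m)" using Suc by blast
      moreover have "topspace Y - C \<in> (\<Union>m\<in>{..<n}. additive_class Y m)" if "C \<in> \<C>" for C
        using C(3) that less.IH by blast
      ultimately have "?D \<subseteq> (\<Union>m\<in>{..<n}. additive_class Y m)" by blast
      moreover have "countable ?D" "?D \<noteq> {}" "topspace Y - S = \<Inter>?D" using C by auto
      ultimately show "topspace Y - S \<in> multiplicative_class Y n"
        unfolding Suc multiplicative_class.simps by blast
    next
      fix S assume "S \<in> multiplicative_class Y n"
      then obtain \<C> where C: "S = \<Inter>\<C>" "countable \<C>"
          "\<C> \<subseteq> (\<Union>m\<in>{..<n}. additive_class Y m)"
        using Suc by auto
      let ?D = "(\<lambda>C. topspace Y - C) ` \<C>"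
      have "topspace Y - C \<in> (\<Union>m\<in>{..<n}. multiplicative_class Y m)" if "C \<in> \<C>" for C
        using C(3) that less.IH by blast
      then have "?D \<subseteq> (\<Union>m\<in>{..<n}. multiplicative_class Y m)" by blast
      moreover have "countable ?D" "topspace Y - S = \<Union>?D" using C by auto
      ultimately show "topspace Y - S \<in> additive_class Y n"
        unfolding Suc additive_class.simps by blast
    qed
  qed
qed

lemma closedin_imp_additive_class:
  assumes "closedin Y S" "n \<ge> 1"
  shows "S \<in> additive_class Y n"
proof -
  obtain k where k: "n = Suc k" using assms(2) by (cases n) auto
  have "S \<in> multiplicative_class Y 0" using assms(1) by simp
  then have "{S} \<subseteq> (\<Union>m\<in>{..<Suc k}. multiplicative_class Y m)" by blast
  then show ?thesis unfolding k additive_class.simps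
    by (metis (mono_tags, lifting) CollectI ccpo_Sup_singleton countable_empty countable_insert)
qed

text \<open>Countable unions and intersections commute with intersecting by \<open>S\<close>, so the
  inductive step lifts each member of a family separately. \<open>S\<close> may be arbitrary because
  nothing is claimed about the class of the trace itself in \<open>Y\<close>.\<close>

lemma Borel_class_trace:
  "(\<forall>T \<in> additive_class (subtopology Y S) n. \<exists>T' \<in> additive_class Y n. T = T' \<inter> S) \<and>
   (\<forall>T \<in> multiplicative_class (subtopology Y S) n. \<exists>T' \<in> multiplicative_class Y n. T = T' \<inter> S)"
proof (induction n rule: less_induct)
  case (less n)
  show ?case
  proof (cases n)
    case 0
    then show ?thesis by (auto simp: openin_subtopology closedin_subtopology)
  next
    case (Suc k)
    show ?thesis
    proof (intro conjI ballI)
      fix T assume "T \<in> additive_class (subtopology Y S) n"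
      then obtain \<C> where C: "T = \<Union>\<C>" "countable \<C>"
          "\<C> \<subseteq> (\<Union>m\<in>{..<n}. multiplicative_class (subtopology Y S) m)"
        using Suc by auto
      have "\<exists>C'. C' \<in> (\<Union>m\<in>{..<n}. multiplicative_class Y m) \<and> C = C' \<inter> S" if "C \<in> \<C>" for C
      proof -
        obtain m where m: "m < n" "C \<in> multiplicative_class (subtopology Y S) m"
          using C(3) \<open>C \<in> \<C>\<close> by blast
        then obtain C' where "C' \<in> multiplicative_class Y m" "C = C' \<inter> S"
          using less.IH[OF m(1)] by meson
        then show ?thesis using m(1) by blast
      qed
      then obtain h where h: "\<And>C. C \<in> \<C> \<Longrightarrow> h C \<in> (\<Union>m\<in>{..<n}. multiplicative_class Y m) \<and> C = h C \<inter> S"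
        by metis
      have "h ` \<C> \<subseteq> (\<Union>m\<in>{..<n}. multiplicative_class Y m)" using h by blast
      moreover have "countable (h ` \<C>)" using C(2) by simp
      ultimately have "\<Union>(h ` \<C>) \<in> additive_class Y n"
        unfolding Suc additive_class.simps by blast
      moreover have "T = \<Union>(h ` \<C>) \<inter> S" using C(1) h by blast
      ultimately show "\<exists>T' \<in> additive_class Y n. T = T' \<inter> S" by blast
    next
      fix T assume "T \<in> multiplicative_class (subtopology Y S) n"
      then obtain \<C> where C: "T = \<Inter>\<C>" "countable \<C>" "\<C> \<noteq> {}"
          "\<C> \<subseteq> (\<Union>m\<in>{..<n}. additive_class (subtopology Y S) m)"
        using Suc by auto
      have "\<exists>C'. C' \<in> (\<Union>m\<in>{..<n}. additive_class Y m) \<and> C = C' \<inter> S" if "C \<in> \<C>" for C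
      proof -
        obtain m where m: "m < n" "C \<in> additive_class (subtopology Y S) m"
          using C(4) \<open>C \<in> \<C>\<close> by blast
        then obtain C' where "C' \<in> additive_class Y m" "C = C' \<inter> S"
          using less.IH[OF m(1)] by meson
        then show ?thesis using m(1) by blast
      qed
      then obtain h where h: "\<And>C. C \<in> \<C> \<Longrightarrow> h C \<in> (\<Union>m\<in>{..<n}. additive_class Y m) \<and> C = h C \<inter> S"
        by metis
      have "h ` \<C> \<subseteq> (\<Union>m\<in>{..<n}. additive_class Y m)" using h by blast
      moreover have "countable (h ` \<C>)" "h ` \<C> \<noteq> {}" using C(2,3) by auto
      ultimately have "\<Inter>(h ` \<C>) \<in> multiplicative_class Y n"
        unfolding Suc multiplicative_class.simps by blast
      moreover have "T = \<Inter>(h ` \<C>) \<inter> S" using C(1,3) h by blast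
      ultimately show "\<exists>T' \<in> multiplicative_class Y n. T = T' \<inter> S" by blast
    qed
  qed
qed

section \<open>Borel classes of G-delta subspaces\<close>

lemma gdelta_in_imp_Inter_opens:
  assumes "gdelta_in Y S"
  obtains \<D> where "countable \<D>" "\<D> \<noteq> {}" "\<D> \<subseteq> Collect (openin Y)" "S = \<Inter>\<D>"
proof -
  obtain \<D> where D: "countable \<D>" "\<D> \<subseteq> Collect (openin Y)" "\<Inter>\<D> = S"
    using assms unfolding gdelta_in_alt intersection_of_def by auto
  moreover have "S \<subseteq> topspace Y" using assms unfolding gdelta_in_alt by blast
  ultimately show ?thesis by (intro that[of "insert (topspace Y) \<D>"]) auto
qed

text \<open>\<open>Suc (m - 1)\<close> is the maximum of \<open>m\<close> and 1: a closed set is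
  itself a G-delta set, which raises class 0 to class 1, and from class 1 on the open sets that cut
  out \<open>S\<close> can be added to the family for \<open>T\<close>.\<close>

lemma multiplicative_class_Int_gdelta:
  assumes Y: "metrizable_space Y" and S: "gdelta_in Y S"
    and T: "T \<in> multiplicative_class Y m"
  shows "T \<inter> S \<in> multiplicative_class Y (Suc (m - 1))"
proof -
  have "\<exists>\<C>. countable \<C> \<and> \<C> \<noteq> {} \<and> \<C> \<subseteq> (\<Union>j\<in>{..<Suc (m - 1)}. additive_class Y j) \<and> T = \<Inter>\<C>"
  proof (cases m)
    case 0
    then have "gdelta_in Y T" using T closed_imp_gdelta_in[OF Y] by simp
    then obtain \<C> where "countable \<C>" "\<C> \<noteq> {}" "\<C> \<subseteq> Collect (openin Y)" "T = \<Inter>\<C>"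
      by (rule gdelta_in_imp_Inter_opens)
    then show ?thesis using 0 by auto
  next
    case (Suc k)
    then show ?thesis using T by auto
  qed
  then obtain \<C> where C: "countable \<C>" "\<C> \<noteq> {}"
      "\<C> \<subseteq> (\<Union>j\<in>{..<Suc (m - 1)}. additive_class Y j)" "T = \<Inter>\<C>" by blast
  obtain \<D> where D: "countable \<D>" "\<D> \<noteq> {}" "\<D> \<subseteq> Collect (openin Y)" "S = \<Inter>\<D>"
    using S by (rule gdelta_in_imp_Inter_opens)
  have "\<D> \<subseteq> additive_class Y 0" using D(3) by simp
  then have "\<D> \<subseteq> (\<Union>j\<in>{..<Suc (m - 1)}. additive_class Y j)" by blast
  then have "\<C> \<union> \<D> \<subseteq> (\<Union>j\<in>{..<Suc (m - 1)}. additive_class Y j)" using C(3) by blast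
  moreover have "T \<inter> S = \<Inter>(\<C> \<union> \<D>)" "countable (\<C> \<union> \<D>)" "\<C> \<union> \<D> \<noteq> {}"
    using C D by auto
  ultimately show ?thesis unfolding multiplicative_class.simps by blast
qed

text \<open>Each multiplicative set in the union is intersected with \<open>S\<close>. This raises
  its class to at most the maximum of its own class and 1, which stays below \<open>n\<close>
  because \<open>n\<close> is at least 2.\<close>

lemma additive_class_gdelta_subspace:
  assumes Y: "metrizable_space Y" and S: "gdelta_in Y S"
    and T: "T \<in> additive_class (subtopology Y S) n" and n: "n \<ge> 2"
  shows "T \<in> additive_class Y n"
proof -
  obtain k where k: "n = Suc (Suc k)" using n by (metis add_2_eq_Suc le_Suc_ex)
  obtain T' where "T' \<in> additive_class Y n" and TT': "T = T' \<inter> S"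
    using Borel_class_trace T by meson
  then obtain \<C> where C: "T' = \<Union>\<C>" "countable \<C>" "\<C> \<subseteq> (\<Union>m\<in>{..<n}. multiplicative_class Y m)"
    unfolding k additive_class.simps by blast
  have "C \<inter> S \<in> (\<Union>m\<in>{..<n}. multiplicative_class Y m)" if "C \<in> \<C>" for C
  proof -
    obtain m where "m < n" "C \<in> multiplicative_class Y m" using C(3) \<open>C \<in> \<C>\<close> by blast
    then have "C \<inter> S \<in> multiplicative_class Y (Suc (m - 1))" "Suc (m - 1) < n"
      using multiplicative_class_Int_gdelta[OF Y S] k by auto
    then show ?thesis by blast
  qed
  then have "(\<lambda>C. C \<inter> S) ` \<C> \<subseteq> (\<Union>m\<in>{..<n}. multiplicative_class Y m)" by blast
  moreover have "T = \<Union>((\<lambda>C. C \<inter> S) ` \<C>)" using C(1) TT' by blast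
  moreover have "countable ((\<lambda>C. C \<inter> S) ` \<C>)" using C(2) by simp
  ultimately show ?thesis
    unfolding k additive_class.simps by blast
qed

section \<open>Uniform distance between nonnegative maps\<close>

text \<open>At each pair of points the two values are equal or both at most \<open>t\<close>.
  Quantifying over the whole type frees the relation from \<open>X\<close>; this agrees with the
  condition in \<open>UD\<close> since members of \<open>UMet_bd X R\<close> vanish off the
  space.\<close>

definition equal_above :: "real \<Rightarrow> ('a \<Rightarrow> 'a \<Rightarrow> real) \<Rightarrow> ('a \<Rightarrow> 'a \<Rightarrow> real) \<Rightarrow> bool" where
  "equal_above t d e \<longleftrightarrow> (\<forall>x y. d x y \<le> max (e x y) t \<and> e x y \<le> max (d x y) t)"

text \<open>This is the ambient metrizable space for \<open>UMet_bd X R\<close>. It also has to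
  contain those maps \<open>glue q p\<close> that lie outside \<open>UMet_bd X R\<close>.\<close>

definition nonneg_maps :: "('a \<Rightarrow> 'a \<Rightarrow> real) set" where
  "nonneg_maps = {d. \<forall>x y. 0 \<le> d x y}"

text \<open>
  Truncating at 1 makes this a real-valued metric on all nonnegative maps; unlike in \<^const>\<open>UD\<close>,
  the infimum is not restricted to \<open>R\<close>, so that it is attained.
\<close>

definition uniform_dist :: "('a \<Rightarrow> 'a \<Rightarrow> real) \<Rightarrow> ('a \<Rightarrow> 'a \<Rightarrow> real) \<Rightarrow> real" where
  "uniform_dist d e = Inf {t. 0 \<le> t \<and> (1 \<le> t \<or> equal_above t d e)}"

lemma equal_above_sym: "equal_above t d e \<longleftrightarrow> equal_above t e d"
  unfolding equal_above_def by blast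

lemma equal_above_mono: "equal_above s d e \<Longrightarrow> s \<le> t \<Longrightarrow> equal_above t d e"
  unfolding equal_above_def by (meson max.mono order_refl order_trans)

lemma equal_above_trans:
  assumes "equal_above s d e" "equal_above t e f"
  shows "equal_above (max s t) d f"
  unfolding equal_above_def
proof (intro allI conjI)
  fix x y
  have "d x y \<le> max (e x y) s" "e x y \<le> max (d x y) s" "e x y \<le> max (f x y) t" "f x y \<le> max (e x y) t"
    using assms unfolding equal_above_def by blast+
  then show "d x y \<le> max (f x y) (max s t)" "f x y \<le> max (d x y) (max s t)" by linarith+
qed

lemma uniform_dist_le:
  assumes "0 \<le> t" "1 \<le> t \<or> equal_above t d e"
  shows "uniform_dist d e \<le> t"
proof -
  have "bdd_below {t. 0 \<le> t \<and> (1 \<le> t \<or> equal_above t d e)}" by (rule bdd_belowI[of _ 0]) simp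
  then show ?thesis unfolding uniform_dist_def using assms by (intro cInf_lower) auto
qed

lemma uniform_dist_less_imp:
  assumes "uniform_dist d e < s" "s \<le> 1"
  shows "equal_above s d e"
proof -
  let ?T = "{t. 0 \<le> t \<and> (1 \<le> t \<or> equal_above t d e)}"
  have "1 \<in> ?T" by simp
  then obtain u where "u \<in> ?T" "u < s"
    using assms(1) cInf_lessD[of ?T s] unfolding uniform_dist_def by blast
  then show ?thesis using equal_above_mono[of u d e s] assms(2) by auto
qed

lemma uniform_dist_nonneg: "0 \<le> uniform_dist d e"
  unfolding uniform_dist_def by (rule cInf_greatest) (auto intro: exI[of _ 1])

lemma uniform_dist_sym: "uniform_dist d e = uniform_dist e d"
  unfolding uniform_dist_def using equal_above_sym[of _ d e] by simp

lemma uniform_dist_ultra: "uniform_dist d f \<le> max (uniform_dist d e) (uniform_dist e f)"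
proof (rule field_le_epsilon)
  fix \<epsilon> :: real assume \<epsilon>: "0 < \<epsilon>"
  define s where "s = max (uniform_dist d e) (uniform_dist e f) + \<epsilon>"
  have s: "uniform_dist d e < s" "uniform_dist e f < s"
    unfolding s_def using \<epsilon> by (auto simp: max_def)
  have "0 \<le> s" using s uniform_dist_nonneg[of d e] by linarith
  moreover have "1 \<le> s \<or> equal_above s d f"
    using uniform_dist_less_imp[OF s(1)] uniform_dist_less_imp[OF s(2)] equal_above_trans[of s d e s f]
    by force
  ultimately show "uniform_dist d f \<le> max (uniform_dist d e) (uniform_dist e f) + \<epsilon>"
    using uniform_dist_le s_def by blast
qed

lemma uniform_dist_eq_0_iff:
  assumes "d \<in> nonneg_maps" "e \<in> nonneg_maps"
  shows "uniform_dist d e = 0 \<longleftrightarrow> d = e"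
proof
  assume "d = e"
  then have "uniform_dist d e \<le> 0" by (intro uniform_dist_le) (auto simp: equal_above_def)
  then show "uniform_dist d e = 0" using uniform_dist_nonneg[of d e] by simp
next
  assume 0: "uniform_dist d e = 0"
  have "d x y = e x y" for x y
  proof (rule ccontr)
    assume neq: "d x y \<noteq> e x y"
    \<comment> \<open>The threshold lies strictly below the larger of the two values, so being equal
      above \<open>s\<close> forces them to coincide; the bound 1 keeps it within the range where
      the truncated distance still gives information.\<close>
    define s where "s = min 1 (max (d x y) (e x y) / 2)"
    have "0 \<le> d x y" "0 \<le> e x y" using assms unfolding nonneg_maps_def by auto
    then have "0 < s" "s < max (d x y) (e x y)" using neq unfolding s_def by (auto simp: max_def)
    then have "equal_above s d e" using uniform_dist_less_imp[of d e s] 0 unfolding s_def by auto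
    then have "d x y \<le> max (e x y) s" "e x y \<le> max (d x y) s" unfolding equal_above_def by auto
    then show False using neq \<open>s < max (d x y) (e x y)\<close> by linarith
  qed
  then show "d = e" by blast
qed

lemma Metric_space_uniform_dist: "Metric_space nonneg_maps uniform_dist"
proof
  fix d e f :: "'a \<Rightarrow> 'a \<Rightarrow> real"
  show "0 \<le> uniform_dist d e" by (rule uniform_dist_nonneg)
  show "uniform_dist d e = uniform_dist e d" by (rule uniform_dist_sym)
  show "uniform_dist d f \<le> uniform_dist d e + uniform_dist e f"
    using uniform_dist_ultra[of d f e] uniform_dist_nonneg[of d e] uniform_dist_nonneg[of e f]
    by linarith
  show "uniform_dist d e = 0 \<longleftrightarrow> d = e" if "d \<in> nonneg_maps" "e \<in> nonneg_maps"
    using uniform_dist_eq_0_iff that .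
qed

section \<open>The space of ultrametrics as a subspace of the nonnegative maps\<close>

lemma characteristic_less:
  assumes "range_set R" "characteristic R" "0 < \<epsilon>"
  obtains r where "r \<in> R" "0 < r" "r < \<epsilon>"
proof -
  have "Inf (ereal ` (R - {0})) < ereal \<epsilon>"
    using assms(2,3) unfolding characteristic_def by simp
  then obtain r where "r \<in> R - {0}" "r < \<epsilon>" unfolding Inf_less_iff by auto
  then show ?thesis using that[of r] assms(1) unfolding range_set_def
    by (metis DiffE atLeast_iff insertCI order_le_less subsetD)
qed

lemma UD_less_iff:
  assumes "d \<in> UMet_bd X R" "e \<in> UMet_bd X R" "range_set R" 
  shows "UD (topspace X) R d e < ereal \<epsilon> \<longleftrightarrow> (\<exists>t\<in>R. 0 < t \<and> t < \<epsilon> \<and> equal_above t d e)"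
proof -
  let ?M = "topspace X"
  have "pseudo_ultrametric_on ?M d" "pseudo_ultrametric_on ?M e"
    using assms(1,2) unfolding UMet_bd_def ultrametric_on_def by blast+
  then have 0: "d x y = 0 \<and> e x y = 0" if "x \<notin> ?M \<or> y \<notin> ?M" for x y
    using that unfolding pseudo_ultrametric_on_def by blast
  have eq: "(\<forall>x\<in>?M. \<forall>y\<in>?M. d x y \<le> max (e x y) t \<and> e x y \<le> max (d x y) t) \<longleftrightarrow> equal_above t d e" for t
  proof
    assume *: "\<forall>x\<in>?M. \<forall>y\<in>?M. d x y \<le> max (e x y) t \<and> e x y \<le> max (d x y) t"
    have "d x y \<le> max (e x y) t \<and> e x y \<le> max (d x y) t" for x y
      using * 0[of x y] by (cases "x \<in> ?M \<and> y \<in> ?M") auto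
    then show "equal_above t d e" unfolding equal_above_def by blast
  qed (simp add: equal_above_def)
  have pos: "{t \<in> R - {0}. equal_above t d e} = {t \<in> R. 0 < t \<and> equal_above t d e}"
    using assms(3) unfolding range_set_def by force
  show ?thesis unfolding UD_def Inf_less_iff eq pos by auto
qed

lemma UMet_bd_subset_nonneg_maps: "UMet_bd X R \<subseteq> nonneg_maps"
proof
  fix d assume "d \<in> UMet_bd X R"
  then have "pseudo_ultrametric_on (topspace X) d" unfolding UMet_bd_def ultrametric_on_def by blast
  then have "0 \<le> d x y" for x y unfolding pseudo_ultrametric_on_def
    by (cases "x \<in> topspace X \<and> y \<in> topspace X") auto
  then show "d \<in> nonneg_maps" unfolding nonneg_maps_def by simp
qed

abbreviation uniform_topology :: "('a \<Rightarrow> 'a \<Rightarrow> real) topology" where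
  "uniform_topology \<equiv> Metric_space.mtopology nonneg_maps uniform_dist"

text \<open>\<open>UD\<close> and \<open>uniform_dist\<close> differ by the truncation and by the
  restriction of thresholds to \<open>R\<close>. Neither affects small balls, since \<open>R\<close>
  contains arbitrarily small positive thresholds.\<close>

lemma UMet_bd_space_eq:
  assumes R: "range_set R" "characteristic R"
  shows "UMet_bd_space X R = subtopology uniform_topology (UMet_bd X R)"
proof -
  interpret Metric_space "nonneg_maps :: ('a \<Rightarrow> 'a \<Rightarrow> real) set" uniform_dist
    by (rule Metric_space_uniform_dist)
  let ?U = "UMet_bd X R"
  let ?B = "{{e \<in> ?U. UD (topspace X) R d e < ereal \<epsilon>} | d \<epsilon>. d \<in> ?U \<and> 0 < \<epsilon>}"
  have ball: "{e \<in> ?U. UD (topspace X) R d e < ereal \<epsilon>} = 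
      {e \<in> ?U. \<exists>t\<in>R. 0 < t \<and> t < \<epsilon> \<and> equal_above t d e}" if "d \<in> ?U" for d \<epsilon>
    using UD_less_iff[OF that _ R(1)] by blast
  have gen: "openin (subtopology mtopology ?U) S" if S: "S \<in> ?B" for S
  proof -
    obtain d \<epsilon> where d: "d \<in> ?U" "S = {e \<in> ?U. \<exists>t\<in>R. 0 < t \<and> t < \<epsilon> \<and> equal_above t d e}"
      using S ball by blast
    have "\<exists>W. openin (subtopology mtopology ?U) W \<and> e \<in> W \<and> W \<subseteq> S" if "e \<in> S" for e
    proof -
      obtain t where t: "t \<in> R" "0 < t" "t < \<epsilon>" "equal_above t d e" and e: "e \<in> ?U"
        using \<open>e \<in> S\<close> d(2) by blast
      \<comment> \<open>Combining threshold \<open>t\<close> from \<open>d\<close> to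
        \<open>e\<close> with threshold at most \<open>t\<close> from \<open>e\<close> to
        \<open>f\<close> gives \<open>t\<close> again, so the ball around \<open>e\<close> needs no
        smaller radius.\<close>
      let ?W = "mball e (min 1 t) \<inter> ?U"
      have "?W \<subseteq> S"
      proof
        fix f assume f: "f \<in> ?W"
        then have "equal_above (min 1 t) e f" by (intro uniform_dist_less_imp) auto
        then have "equal_above t d f"
          using equal_above_trans[OF t(4)] by (metis max_absorb1 min.cobounded2)
        then show "f \<in> S" using f t d(2) by blast
      qed
      moreover have "openin (subtopology mtopology ?U) ?W" by (simp add: openin_subtopology_Int)
      moreover have "e \<in> ?W" using e t UMet_bd_subset_nonneg_maps
        by (auto simp: mdist_zero subset_iff)
      ultimately show ?thesis by blast
    qed
    then show ?thesis by (subst openin_subopen) blast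
  qed
  have "openin (UMet_bd_space X R) S" if S: "openin (subtopology mtopology ?U) S" for S
  proof -
    obtain V where V: "openin mtopology V" "S = V \<inter> ?U" using S by (auto simp: openin_subtopology)
    have "\<exists>W. openin (UMet_bd_space X R) W \<and> d \<in> W \<and> W \<subseteq> S" if "d \<in> S" for d
    proof -
      have d: "d \<in> V" "d \<in> ?U" using \<open>d \<in> S\<close> V(2) by auto
      obtain \<epsilon> where \<epsilon>: "0 < \<epsilon>" "mball d \<epsilon> \<subseteq> V" using d(1) V(1) unfolding openin_mtopology by blast
      let ?W = "{e \<in> ?U. UD (topspace X) R d e < ereal \<epsilon>}"
      have "openin (UMet_bd_space X R) ?W"
        unfolding UMet_bd_space_def openin_topology_generated_by_iff
        using d(2) \<epsilon>(1) by (intro generate_topology_on.Basis) blast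
      moreover have "d \<in> ?W"
      proof -
        \<comment> \<open>\<open>UD\<close> admits only nonzero thresholds from \<open>R\<close>;
          that \<open>R\<close> is characteristic puts \<open>d\<close> into its own ball.\<close>
        obtain t where "t \<in> R" "0 < t" "t < \<epsilon>" using characteristic_less[OF R \<epsilon>(1)] .
        moreover have "equal_above t d d" unfolding equal_above_def by simp
        ultimately show ?thesis unfolding ball[OF d(2)] using d(2) by blast
      qed
      moreover have "?W \<subseteq> S"
      proof
        fix e assume e: "e \<in> ?W"
        then obtain t where t: "0 < t" "t < \<epsilon>" "equal_above t d e" unfolding ball[OF d(2)] by blast
        then have "uniform_dist d e < \<epsilon>" using uniform_dist_le[of t d e] by linarith
        then have "e \<in> mball d \<epsilon>" using e d(2) UMet_bd_subset_nonneg_maps by auto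
        then show "e \<in> S" using e \<epsilon>(2) V(2) by blast
      qed
      ultimately show ?thesis by blast
    qed
    then show ?thesis by (subst openin_subopen) blast
  qed
  moreover have "openin (subtopology mtopology ?U) S" if S: "openin (UMet_bd_space X R) S" for S
  proof (rule generate_topology_on_coarsest[of "openin (subtopology mtopology ?U)" ?B])
    show "generate_topology_on ?B S"
      using S unfolding UMet_bd_space_def openin_topology_generated_by_iff .
  qed (use gen in auto)
  ultimately show ?thesis unfolding topology_eq by blast
qed

text \<open>The hypothesis concerns one carrier type. Universality moves it to the type of maps,
  where the inclusion \<open>id\<close> into \<open>nonneg_maps\<close> is one of the embeddings to
  which it applies.\<close>

lemma UMet_bd_multiplicative_class:
  assumes R: "range_set R" "characteristic R"
    and M: "absolute_multiplicative TYPE(nat \<Rightarrow> 'a \<Rightarrow> 'a \<Rightarrow> real) n (UMet_bd_space (X :: 'a topology) R)"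
  shows "UMet_bd X R \<in> multiplicative_class uniform_topology n"
proof -
  interpret Metric_space "nonneg_maps :: ('a \<Rightarrow> 'a \<Rightarrow> real) set" uniform_dist
    by (rule Metric_space_uniform_dist)
  have top: "topspace (UMet_bd_space X R) = UMet_bd X R"
    using UMet_bd_subset_nonneg_maps unfolding UMet_bd_space_eq[OF R] by auto
  have "embedding_map (UMet_bd_space X R) mtopology id"
    unfolding UMet_bd_space_eq[OF R] embedding_map_def
    by (simp add: Int_absorb1 UMet_bd_subset_nonneg_maps)
  moreover have "absolute_multiplicative TYPE('a \<Rightarrow> 'a \<Rightarrow> real) n (UMet_bd_space X R)"
    using M by (rule absolute_multiplicative_universal)
  ultimately have "id ` topspace (UMet_bd_space X R) \<in> multiplicative_class mtopology n"
    unfolding absolute_multiplicative_def using metrizable_space_mtopology by blast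
  then show ?thesis using top by simp
qed

section \<open>Locally finite covers of metric spaces\<close>

text \<open>
  M. E. Rudin's proof of Stone's theorem. The centres of the balls of radius \<open>\<epsilon>\<close> are well-ordered and
  \<open>\<kappa> x\<close> is the least centre whose ball contains \<open>x\<close>. At stage \<open>n\<close> the set with label \<open>\<alpha>\<close>
  collects the balls of radius \<open>1/2^n\<close> around those points \<open>x\<close> with \<open>\<kappa> x = \<alpha>\<close> that lie
  deep inside the ball of \<open>\<alpha>\<close> and are not covered at an earlier stage.
\<close>

lemma (in Metric_space) locally_finite_small_cover:
  assumes "0 < \<epsilon>"
  obtains U :: "nat \<times> 'a \<Rightarrow> 'a set" where
    "\<And>i. openin mtopology (U i)" "(\<Union>i. U i) = M"
    "\<And>i x y. x \<in> U i \<Longrightarrow> y \<in> U i \<Longrightarrow> d x y < \<epsilon>"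
    "\<And>y. y \<in> M \<Longrightarrow> \<exists>N. openin mtopology N \<and> y \<in> N \<and> finite {i. U i \<inter> N \<noteq> {}}"
proof -
  obtain le :: "('a \<times> 'a) set" where wo: "well_order_on UNIV le" using well_order_on by blast
  have wf: "wf (le - Id)" and lin: "linear_order_on UNIV le"
    using wo unfolding well_order_on_def by auto
  define C where "C \<alpha> = mball \<alpha> (\<epsilon> / 2)" for \<alpha>
  have "\<exists>\<alpha>. x \<in> C \<alpha> \<and> (\<forall>\<beta>. (\<beta>, \<alpha>) \<in> le - Id \<longrightarrow> x \<notin> C \<beta>)" if "x \<in> M" for x
    using wfE_min[OF wf, of x "{\<alpha>. x \<in> C \<alpha>}"] that \<open>0 < \<epsilon>\<close> unfolding C_def by auto
  then obtain \<kappa> where \<kappa>: "\<And>x. x \<in> M \<Longrightarrow> x \<in> C (\<kappa> x)"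
      "\<And>x \<beta>. x \<in> M \<Longrightarrow> (\<beta>, \<kappa> x) \<in> le - Id \<Longrightarrow> x \<notin> C \<beta>" by metis
  define r :: "nat \<Rightarrow> real" where "r n = (1 / 2) ^ n" for n
  have r_pos: "0 < r n" and r_Suc: "r n = 2 * r (Suc n)" for n unfolding r_def by auto
  have r_mono: "r n \<le> r m" if "m \<le> n" for m n unfolding r_def using that by (simp add: power_decreasing)
  have r_small: "\<exists>n. r n < t" if "0 < t" for t
    unfolding r_def using real_arch_pow_inv[of t "1/2"] that by auto
  define P where "P n \<alpha> G = {x \<in> M. \<kappa> x = \<alpha> \<and> x \<notin> G \<and> mball x (3 * r n) \<subseteq> C \<alpha>}" for n \<alpha> G
  \<comment> \<open>\<open>G n\<close> is the part covered before stage \<open>n\<close>. Only this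
    union enters the recursion; the individual sets \<open>D n \<alpha>\<close> are read off
    afterwards.\<close>
  define G where "G = rec_nat {} (\<lambda>n G. G \<union> (\<Union>\<alpha>. \<Union>x\<in>P n \<alpha> G. mball x (r n)))"
  have G_Suc: "G (Suc n) = G n \<union> (\<Union>\<alpha>. \<Union>x\<in>P n \<alpha> (G n). mball x (r n))" for n
    unfolding G_def by simp
  define D where "D n \<alpha> = (\<Union>x\<in>P n \<alpha> (G n). mball x (r n))" for n \<alpha>
  have G_mono: "G m \<subseteq> G n" if "m \<le> n" for m n
    using that by (induction rule: dec_induct) (auto simp: G_Suc)
  have D_G: "D n \<alpha> \<subseteq> G (Suc n)" for n \<alpha> unfolding D_def G_Suc by blast
  have G_D: "\<exists>m \<alpha>. x \<in> D m \<alpha>" if "x \<in> G n" for x n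
    using that by (induction n) (auto simp: G_Suc D_def, simp add: G_def)
  have D_C: "D n \<alpha> \<subseteq> C \<alpha>" for n \<alpha>
  proof -
    have "mball x (r n) \<subseteq> C \<alpha>" if "x \<in> P n \<alpha> (G n)" for x
      using that mball_subset_concentric[of "r n" "3 * r n" x] r_pos[of n] unfolding P_def by auto
    then show ?thesis unfolding D_def by blast
  qed
  have D_open: "openin mtopology (D n \<alpha>)" for n \<alpha> unfolding D_def by auto
  define U where "U i = D (fst i) (snd i)" for i
  show thesis
  proof
    show "openin mtopology (U i)" for i unfolding U_def by (rule D_open)
    show "d x y < \<epsilon>" if "x \<in> U i" "y \<in> U i" for i x y
    proof -
      have "x \<in> C (snd i)" "y \<in> C (snd i)" using that D_C unfolding U_def by auto
      then have "d (snd i) x < \<epsilon> / 2" "d (snd i) y < \<epsilon> / 2" "x \<in> M" "y \<in> M" "snd i \<in> M"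
        unfolding C_def by auto
      then show ?thesis using triangle''[of x "snd i" y] by linarith
    qed
    \<comment> \<open>Once \<open>r n\<close> is so small that the ball of radius
      \<open>3 * r n\<close> fits into \<open>C (\<kappa> x)\<close>, the point \<open>x\<close> is
      either covered already or a centre at stage \<open>n\<close>.\<close>
    have cover: "\<exists>n \<alpha>. x \<in> D n \<alpha>" if x: "x \<in> M" for x
    proof -
      obtain s where s: "0 < s" "mball x s \<subseteq> C (\<kappa> x)"
        using \<kappa>(1)[OF x] openin_mball[of "\<kappa> x" "\<epsilon> / 2"] unfolding C_def openin_mtopology by blast
      obtain n where n: "r n < s / 3" using r_small[of "s / 3"] s(1) by auto
      have "mball x (3 * r n) \<subseteq> C (\<kappa> x)"
        using s(2) mball_subset_concentric[of "3 * r n" s x] n by auto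
      then have "x \<in> G n \<or> x \<in> D n (\<kappa> x)"
        using x r_pos[of n] unfolding D_def P_def by auto
      then show ?thesis using G_D by blast
    qed
    have "U i \<subseteq> M" for i unfolding U_def using openin_subset[OF D_open] by simp
    moreover have "M \<subseteq> (\<Union>i. U i)"
    proof
      fix x assume "x \<in> M"
      then obtain n \<alpha> where "x \<in> D n \<alpha>" using cover by blast
      then have "x \<in> U (n, \<alpha>)" unfolding U_def by simp
      then show "x \<in> (\<Union>i. U i)" by blast
    qed
    ultimately show "(\<Union>i. U i) = M" by blast
    fix y assume y: "y \<in> M"
    obtain n \<alpha> where "y \<in> D n \<alpha>" using cover[OF y] by blast
    then obtain s where s: "0 < s" "mball y s \<subseteq> D n \<alpha>"
      using D_open[of n \<alpha>] unfolding openin_mtopology by blast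
    obtain j where j: "r j < s" using r_small[OF s(1)] by blast
    define N where "N = mball y (r (Suc (n + j)))"
    \<comment> \<open>Centres of later stages avoid \<open>D n \<alpha>\<close> and so have distance
      at least \<open>s\<close> from \<open>y\<close>, while their radius and that of
      \<open>N\<close> are at most \<open>r (Suc j)\<close>, which is half of
      \<open>r j\<close>.\<close>
    have late: "D m \<beta> \<inter> N = {}" if "Suc (n + j) \<le> m" for m \<beta>
    proof (rule ccontr)
      assume "D m \<beta> \<inter> N \<noteq> {}"
      then obtain x z where x: "x \<in> P m \<beta> (G m)" "z \<in> mball x (r m)" "z \<in> N"
        unfolding D_def by blast
      have "D n \<alpha> \<subseteq> G m" using D_G[of n \<alpha>] G_mono[of "Suc n" m] that by auto
      then have "x \<notin> mball y s" using x(1) s(2) unfolding P_def by blast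
      then have "s \<le> d y x" using x y by auto
      moreover have "d y x \<le> d y z + d x z" using x y unfolding N_def by (auto simp: triangle'')
        (metis commute triangle)
      moreover have "d y z < r (Suc (n + j))" "d x z < r m" using x unfolding N_def by auto
      moreover have "r m \<le> r (Suc j)" "r (Suc (n + j)) \<le> r (Suc j)" using that by (auto intro: r_mono)
      ultimately show False using j r_Suc[of j] by linarith
    qed
    have early: "\<alpha>1 = \<alpha>2" if m: "m < Suc (n + j)" and "D m \<alpha>1 \<inter> N \<noteq> {}" "D m \<alpha>2 \<inter> N \<noteq> {}" for m \<alpha>1 \<alpha>2
    proof -
      \<comment> \<open>At one stage, centres \<open>u\<close> and \<open>v\<close> with different
        labels are at least \<open>3 * r m\<close> apart: by minimality of \<open>\<kappa> v\<close>
        the point \<open>v\<close> is not in \<open>C \<beta>\<close>, which contains the ball of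
        that radius around \<open>u\<close>. A common small neighbourhood \<open>N\<close> would
        bring them closer.\<close>
      have *: False if "(\<beta>, \<gamma>) \<in> le - Id" "D m \<beta> \<inter> N \<noteq> {}" "D m \<gamma> \<inter> N \<noteq> {}" for \<beta> \<gamma>
      proof -
        obtain u p where u: "u \<in> P m \<beta> (G m)" "p \<in> mball u (r m)" "p \<in> N"
          using \<open>D m \<beta> \<inter> N \<noteq> {}\<close> unfolding D_def by blast
        obtain v q where v: "v \<in> P m \<gamma> (G m)" "q \<in> mball v (r m)" "q \<in> N"
          using \<open>D m \<gamma> \<inter> N \<noteq> {}\<close> unfolding D_def by blast
        have M: "u \<in> M" "v \<in> M" "p \<in> M" "q \<in> M" using u v by auto
        have "v \<notin> C \<beta>" using \<kappa>(2)[of v \<beta>] v(1) that(1) unfolding P_def by auto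
        then have "v \<notin> mball u (3 * r m)" using u(1) unfolding P_def by auto
        then have "3 * r m \<le> d u v" using M by auto
        moreover have "d u p < r m" "d v q < r m" "d y p < r (Suc (n + j))" "d y q < r (Suc (n + j))"
          using u v unfolding N_def by auto
        moreover have "d u v \<le> d u p + d p v" "d p v \<le> d p q + d v q" "d p q \<le> d y p + d y q"
          using M y triangle triangle' triangle'' by (auto simp: commute) (metis commute triangle)+
        moreover have "2 * r (Suc (n + j)) \<le> r m" using r_Suc[of "n + j"] r_mono[of m "n + j"] m by simp
        ultimately show False by linarith
      qed
      show ?thesis
      proof (rule ccontr)
        assume "\<alpha>1 \<noteq> \<alpha>2"
        then have "(\<alpha>1, \<alpha>2) \<in> le - Id \<or> (\<alpha>2, \<alpha>1) \<in> le - Id"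
          using lin unfolding linear_order_on_def total_on_def by auto
        then show False using * that by blast
      qed
    qed
    have less: "fst i < Suc (n + j)" if "U i \<inter> N \<noteq> {}" for i
      using late[of "fst i" "snd i"] that unfolding U_def by (meson not_less)
    have "inj_on fst {i. U i \<inter> N \<noteq> {}}"
    proof (rule inj_onI)
      fix i i' assume *: "i \<in> {i. U i \<inter> N \<noteq> {}}" "i' \<in> {i. U i \<inter> N \<noteq> {}}" "fst i = fst i'"
      then have "snd i = snd i'"
        using early[of "fst i" "snd i" "snd i'"] less[of i] unfolding U_def by auto
      then show "i = i'" using *(3) by (simp add: prod_eq_iff)
    qed
    moreover have "fst ` {i. U i \<inter> N \<noteq> {}} \<subseteq> {..<Suc (n + j)}" using less by blast
    ultimately have "finite {i. U i \<inter> N \<noteq> {}}"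
      by (meson finite_imageD finite_lessThan finite_subset)
    moreover have "openin mtopology N" "y \<in> N" unfolding N_def using y r_pos by auto
    ultimately show "\<exists>N. openin mtopology N \<and> y \<in> N \<and> finite {i. U i \<inter> N \<noteq> {}}" by blast
  qed
qed

section \<open>The Baire space of sequences of labels\<close>

text \<open>The distances of the Baire space are drawn from such a sequence instead of powers of
  1/2, so that they can be taken in \<open>R\<close>.\<close>

locale null_scale =
  fixes r :: "nat \<Rightarrow> real"
  assumes r_pos: "0 < r n"
    and r_Suc: "r (Suc n) < r n"
    and r_null: "0 < \<epsilon> \<Longrightarrow> \<exists>n. r n < \<epsilon>"
begin

definition baire_dist :: "(nat \<Rightarrow> 'i) \<Rightarrow> (nat \<Rightarrow> 'i) \<Rightarrow> real" where
  "baire_dist s t = (if s = t then 0 else r (LEAST k. s k \<noteq> t k))"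

lemma r_less_iff: "r m < r n \<longleftrightarrow> n < m"
proof -
  have "strict_mono (\<lambda>n. - r n)" using r_Suc by (simp add: strict_mono_Suc_iff)
  then show ?thesis using strict_mono_less by fastforce
qed

text \<open>As \<open>r\<close> is strictly decreasing, the inequality says that the first
  difference comes after \<open>n\<close>; index \<open>n\<close> itself is among the agreeing
  ones.\<close>

lemma baire_dist_less_iff: "baire_dist s t < r n \<longleftrightarrow> (\<forall>k\<le>n. s k = t k)"
proof (cases "s = t")
  case False
  then have ex: "\<exists>k. s k \<noteq> t k" by auto
  have "n < (LEAST k. s k \<noteq> t k) \<longleftrightarrow> (\<forall>k\<le>n. s k = t k)"
    using LeastI_ex[OF ex] not_less_Least[of _ "\<lambda>k. s k \<noteq> t k"]
    by (metis le_less_trans not_less)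
  then show ?thesis using False by (simp add: baire_dist_def r_less_iff)
qed (simp add: baire_dist_def r_pos)

lemma baire_dist_nonneg: "0 \<le> baire_dist s t"
  using r_pos by (simp add: baire_dist_def less_imp_le)

lemma baire_dist_eq_0_iff [simp]: "baire_dist s t = 0 \<longleftrightarrow> s = t"
  using r_pos by (simp add: baire_dist_def order_less_imp_not_eq2)

lemma baire_dist_sym: "baire_dist s t = baire_dist t s"
  unfolding baire_dist_def by (simp add: eq_commute)

lemma baire_dist_in: "baire_dist s t \<in> insert 0 (range r)"
  by (simp add: baire_dist_def)

lemma baire_dist_le: "baire_dist s t \<le> r 0"
  using r_less_iff[of 0] r_pos[of 0] by (auto simp: baire_dist_def not_less[symmetric])

text \<open>At the first index where \<open>s\<close> and \<open>u\<close> differ, \<open>t\<close>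
  must differ from one of them.\<close>

lemma baire_dist_ultra: "baire_dist s u \<le> max (baire_dist s t) (baire_dist t u)"
proof (cases "s = u")
  case False
  define L where "L = (LEAST k. s k \<noteq> u k)"
  have "\<exists>k. s k \<noteq> u k" using False by auto
  then have "s L \<noteq> u L" unfolding L_def by (rule LeastI_ex)
  then have "\<not> baire_dist s t < r L \<or> \<not> baire_dist t u < r L"
    unfolding baire_dist_less_iff by auto
  moreover have "baire_dist s u = r L" using False by (simp add: baire_dist_def L_def)
  ultimately show ?thesis by linarith
next
  case True
  then have "baire_dist s u = 0" by simp
  then show ?thesis using baire_dist_nonneg[of s t] by linarith
qed

lemma Metric_space_baire_dist: "Metric_space UNIV baire_dist"
proof
  show "baire_dist s u \<le> baire_dist s t + baire_dist t u" for s t u :: "nat \<Rightarrow> 'i"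
    using baire_dist_ultra[of s u t] baire_dist_nonneg[of s t] baire_dist_nonneg[of t u] by linarith
qed (auto simp: baire_dist_nonneg baire_dist_sym)

abbreviation baire_topology :: "(nat \<Rightarrow> 'i) topology" where
  "baire_topology \<equiv> Metric_space.mtopology UNIV baire_dist"

lemma topspace_baire_topology [simp]: "topspace baire_topology = UNIV"
  using Metric_space.topspace_mtopology[OF Metric_space_baire_dist] .

text \<open>The balls are the cylinders, so the topology is the product of discrete spaces and does
  not depend on \<open>r\<close>.\<close>

lemma openin_baire_topology:
  fixes U :: "(nat \<Rightarrow> 'i) set"
  shows "openin baire_topology U \<longleftrightarrow> (\<forall>s\<in>U. \<exists>n. \<forall>t. (\<forall>k\<le>n. s k = t k) \<longrightarrow> t \<in> U)"
proof -
  have "(\<exists>\<epsilon>>0. {t. baire_dist s t < \<epsilon>} \<subseteq> U) \<longleftrightarrow> (\<exists>n. {t. baire_dist s t < r n} \<subseteq> U)" for s :: "nat \<Rightarrow> 'i"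
  proof
    assume "\<exists>\<epsilon>>0. {t. baire_dist s t < \<epsilon>} \<subseteq> U"
    then obtain \<epsilon> where \<epsilon>: "0 < \<epsilon>" "{t. baire_dist s t < \<epsilon>} \<subseteq> U" by blast
    obtain n where "r n < \<epsilon>" using r_null[OF \<epsilon>(1)] by blast
    then have "{t. baire_dist s t < r n} \<subseteq> U" using \<epsilon>(2) by auto
    then show "\<exists>n. {t. baire_dist s t < r n} \<subseteq> U" by blast
  qed (use r_pos in blast)
  then show ?thesis
    unfolding Metric_space.openin_mtopology[OF Metric_space_baire_dist]
      Metric_space.mball_def[OF Metric_space_baire_dist] baire_dist_less_iff
    by (simp add: subset_iff Ball_def)
qed

lemma limitin_baire_topology:
  "limitin baire_topology x p sequentially \<longleftrightarrow> (\<forall>k. \<forall>\<^sub>F j in sequentially. x j k = p k)"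
  unfolding limitin_def topspace_baire_topology
proof safe
  fix k
  assume lim: "\<forall>U. openin baire_topology U \<and> p \<in> U \<longrightarrow> (\<forall>\<^sub>F j in sequentially. x j \<in> U)"
  have "openin baire_topology {t. t k = p k}" unfolding openin_baire_topology
    by (metis (mono_tags, lifting) mem_Collect_eq order_refl)
  then show "\<forall>\<^sub>F j in sequentially. x j k = p k" using lim by force
next
  fix U assume *: "\<forall>k. \<forall>\<^sub>F j in sequentially. x j k = p k" and U: "openin baire_topology U" "p \<in> U"
  obtain n where n: "\<And>t. \<forall>k\<le>n. p k = t k \<Longrightarrow> t \<in> U" using U unfolding openin_baire_topology by blast
  have "\<forall>\<^sub>F j in sequentially. \<forall>k\<in>{..n}. x j k = p k"
    using * by (intro eventually_ball_finite) auto
  then show "\<forall>\<^sub>F j in sequentially. x j \<in> U" by eventually_elim (auto intro: n)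
qed simp

end

lemma null_scale_in_characteristic:
  assumes R: "range_set R" "characteristic R"
  obtains r where "null_scale r" "range r \<subseteq> R"
proof -
  have "\<exists>r. \<forall>n. (r n \<in> R \<and> 0 < r n \<and> r n < 1 / real (Suc n)) \<and> r (Suc n) < r n"
  proof (rule dependent_nat_choice)
    show "\<exists>t. t \<in> R \<and> 0 < t \<and> t < 1 / real (Suc 0)" using characteristic_less[OF R, of 1] by auto
    fix t n assume "t \<in> R \<and> 0 < t \<and> t < 1 / real (Suc n)"
    then have "0 < min t (1 / real (Suc (Suc n)))" by simp
    then obtain u where "u \<in> R" "0 < u" "u < min t (1 / real (Suc (Suc n)))"
      using characteristic_less[OF R] by blast
    then show "\<exists>u. (u \<in> R \<and> 0 < u \<and> u < 1 / real (Suc (Suc n))) \<and> u < t" by auto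
  qed
  then obtain r where r: "\<And>n. r n \<in> R" "\<And>n. 0 < r n" "\<And>n. r n < 1 / real (Suc n)" "\<And>n. r (Suc n) < r n"
    by blast
  have "\<exists>n. r n < \<epsilon>" if "0 < \<epsilon>" for \<epsilon>
  proof -
    obtain n where "1 / real (Suc n) < \<epsilon>" using nat_approx_posE[OF \<open>0 < \<epsilon>\<close>] by blast
    then show ?thesis using r(3)[of n] by (intro exI[of _ n]) linarith
  qed
  then have "null_scale r" using r by unfold_locales auto
  then show ?thesis using that r(1) by blast
qed

section \<open>Labellings of an ultrametrizable subspace\<close>

text \<open>
  The points of \<open>X\<close> in one ball of maximal radius among those contained in a member of the
  cover get the same label.
\<close>

lemma (in Metric_space) small_labelling:
  fixes X :: "'x topology"
  assumes X: "ultrametrizable_space X" and f: "continuous_map X mtopology f" and \<epsilon>: "0 < \<epsilon>"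
  obtains \<pi> :: "'x \<Rightarrow> nat \<times> 'a" where
    "\<And>i. openin X {x \<in> topspace X. \<pi> x = i}"
    "\<And>x y. x \<in> topspace X \<Longrightarrow> y \<in> topspace X \<Longrightarrow> \<pi> x = \<pi> y \<Longrightarrow> d (f x) (f y) < \<epsilon>"
    "\<And>y. y \<in> M \<Longrightarrow> \<exists>N. openin mtopology N \<and> y \<in> N \<and> finite (\<pi> ` {x \<in> topspace X. f x \<in> N})"
proof -
  obtain U :: "nat \<times> 'a \<Rightarrow> 'a set" where U: "\<And>i. openin mtopology (U i)" "(\<Union>i. U i) = M"
    "\<And>i x y. x \<in> U i \<Longrightarrow> y \<in> U i \<Longrightarrow> d x y < \<epsilon>"
    "\<And>y. y \<in> M \<Longrightarrow> \<exists>N. openin mtopology N \<and> y \<in> N \<and> finite {i. U i \<inter> N \<noteq> {}}"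
    using locally_finite_small_cover[OF \<epsilon>] by blast
  let ?M = "topspace X"
  obtain u where u: "ultrametric_on ?M u" and Xu: "Metric_space.mtopology ?M u = X"
    using X unfolding ultrametrizable_space_def by blast
  interpret u: Metric_space ?M u using u by (rule ultrametric_on_imp_Metric_space)
  have ultra: "u x y \<le> max (u x z) (u z y)" if "x \<in> ?M" "y \<in> ?M" "z \<in> ?M" for x y z
    using u that unfolding ultrametric_on_def pseudo_ultrametric_on_def by blast
  have ball_sub: "u.mball x s \<subseteq> u.mball y s" if "x \<in> ?M" "y \<in> ?M" "u x y < s" for x y s
  proof
    fix z assume z: "z \<in> u.mball x s"
    then have "u y z \<le> max (u y x) (u x z)" using ultra that by simp
    moreover have "u y x < s" "u x z < s" using that z u.commute[of x y] by auto
    ultimately show "z \<in> u.mball y s" using that z by simp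
  qed
  have ball_eq: "u.mball x s = u.mball y s" if "y \<in> u.mball x s" for x y s
    using ball_sub[of x y s] ball_sub[of y x s] that u.commute[of x y] by auto
  define good where "good x m i \<longleftrightarrow> f ` u.mball x (1 / real (Suc m)) \<subseteq> U i" for x m i
  define rad where "rad x = (LEAST m. \<exists>i. good x m i)" for x
  \<comment> \<open>The choice depends only on the predicate \<open>good x (rad x)\<close>, so
    points for which these predicates coincide receive the same label.\<close>
  define \<pi> where "\<pi> x = (SOME i. good x (rad x) i)" for x
  have good: "good x (rad x) (\<pi> x)" if x: "x \<in> ?M" for x
  proof -
    have "f x \<in> M" using x f by (auto simp: continuous_map_def)
    then obtain i where i: "f x \<in> U i" using U(2) by blast
    have "openin X {z \<in> ?M. f z \<in> U i}" using f U(1) by (rule openin_continuous_map_preimage)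
    then obtain s where s: "0 < s" "u.mball x s \<subseteq> {z \<in> ?M. f z \<in> U i}"
      using x i u.openin_mtopology[of "{z \<in> ?M. f z \<in> U i}"] unfolding Xu by blast
    obtain m where "1 / real (Suc m) < s" using nat_approx_posE[OF s(1)] by blast
    then have "good x m i"
      using s(2) u.mball_subset_concentric[of "1 / real (Suc m)" s x] unfolding good_def by auto
    then have "\<exists>m i. good x m i" by blast
    then have "\<exists>i. good x (rad x) i" unfolding rad_def by (rule LeastI_ex)
    then show ?thesis unfolding \<pi>_def by (rule someI_ex)
  qed
  \<comment> \<open>A ball around \<open>x\<close> that contains \<open>y\<close> is also the ball
    around \<open>y\<close>, hence \<open>x\<close> and \<open>y\<close> are good for the same
    \<open>m\<close> up to \<open>rad x\<close>. This gives \<open>rad y \<le> rad x\<close> first,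
    and then the same comparison at \<open>rad y\<close> gives equality.\<close>
  have same: "\<pi> y = \<pi> x" if x: "x \<in> ?M" and y: "y \<in> u.mball x (1 / real (Suc (rad x)))" for x y
  proof -
    have eq: "good y m i \<longleftrightarrow> good x m i" if "m \<le> rad x" for m i
    proof -
      have "1 / real (Suc (rad x)) \<le> 1 / real (Suc m)" 
        using that by (simp add: field_simps)
      then have "y \<in> u.mball x (1 / real (Suc m))"
        using y u.mball_subset_concentric by blast
      then have "u.mball x (1 / real (Suc m)) = u.mball y (1 / real (Suc m))" by (rule ball_eq)
      then show ?thesis unfolding good_def by (simp only:)
    qed
    have rad_le: "rad z \<le> m" if "good z m i" for z m i
      unfolding rad_def using Least_le[of "\<lambda>m. \<exists>i. good z m i" m] that by blast
    have "good y (rad x) (\<pi> x)" using eq[of "rad x"] good[OF x] by simp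
    then have le: "rad y \<le> rad x" by (rule rad_le)
    have "y \<in> ?M" using y by simp
    then have "good x (rad y) (\<pi> y)" using eq[OF le] good by blast
    then have "rad x \<le> rad y" by (rule rad_le)
    then have "rad y = rad x" using le by simp
    moreover have "good y (rad x) = good x (rad x)" using eq[of "rad x"] by (simp add: fun_eq_iff)
    ultimately show ?thesis unfolding \<pi>_def by simp
  qed
  have in_U: "f x \<in> U (\<pi> x)" if "x \<in> ?M" for x
  proof -
    have "x \<in> u.mball x (1 / real (Suc (rad x)))" using that by simp
    then show ?thesis using good[OF that] unfolding good_def by blast
  qed
  show thesis
  proof
    show "openin X {x \<in> ?M. \<pi> x = i}" for i
    proof -
      have "\<exists>s>0. u.mball x s \<subseteq> {x \<in> ?M. \<pi> x = i}" if "x \<in> ?M" "\<pi> x = i" for x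
      proof (intro exI conjI)
        show "0 < 1 / real (Suc (rad x))" by simp
        show "u.mball x (1 / real (Suc (rad x))) \<subseteq> {x \<in> ?M. \<pi> x = i}"
          using same[OF that(1)] that(2) u.mball_subset_mspace by blast
      qed
      then show ?thesis using u.openin_mtopology[of "{x \<in> ?M. \<pi> x = i}"] unfolding Xu by blast
    qed
    show "d (f x) (f y) < \<epsilon>" if "x \<in> ?M" "y \<in> ?M" "\<pi> x = \<pi> y" for x y
      using U(3)[OF in_U[OF that(1)]] in_U[OF that(2)] that(3) by simp
    show "\<exists>N. openin mtopology N \<and> y \<in> N \<and> finite (\<pi> ` {x \<in> ?M. f x \<in> N})" if "y \<in> M" for y
    proof -
      obtain N where N: "openin mtopology N" "y \<in> N" "finite {i. U i \<inter> N \<noteq> {}}"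
        using U(4) \<open>y \<in> M\<close> by blast
      have "\<pi> ` {x \<in> ?M. f x \<in> N} \<subseteq> {i. U i \<inter> N \<noteq> {}}" using in_U by blast
      then show ?thesis using N finite_subset by blast
    qed
  qed
qed

text \<open>\<open>label_finite\<close> is required at all points of \<open>Y\<close>, also off the
  image of \<open>X\<close>; it yields convergent subsequences of labels. The partitions for
  different \<open>k\<close> need not refine one another.\<close>

locale labelling = 
  fixes X :: "'x topology" and Y :: "'y topology" and f :: "'x \<Rightarrow> 'y" and \<pi> :: "nat \<Rightarrow> 'x \<Rightarrow> 'i"
  assumes metrizable: "metrizable_space Y" and embedding: "embedding_map X Y f"
    and label_open: "openin X {x \<in> topspace X. \<pi> k x = i}"
    and label_base: "openin X U \<Longrightarrow> x \<in> U \<Longrightarrow> \<exists>k. \<forall>y\<in>topspace X. \<pi> k y = \<pi> k x \<longrightarrow> y \<in> U"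
    and label_finite:
      "y \<in> topspace Y \<Longrightarrow> \<exists>N. openin Y N \<and> y \<in> N \<and> finite (\<pi> k ` {x \<in> topspace X. f x \<in> N})"

text \<open>The label sets at level \<open>k\<close> have mesh \<open>1 / (k + 1)\<close> in a
  metric of \<open>Y\<close>. Since \<open>f\<close> is an embedding, this smallness in
  \<open>Y\<close> gives \<open>label_base\<close> in \<open>X\<close>.\<close>

lemma ex_labelling:
  fixes X :: "'x topology" and Y :: "'y topology"
  assumes X: "ultrametrizable_space X" and Y: "metrizable_space Y" and f: "embedding_map X Y f"
  obtains \<pi> :: "nat \<Rightarrow> 'x \<Rightarrow> nat \<times> 'y" where "labelling X Y f \<pi>"
proof -
  obtain M d where "Metric_space M d" and Yd: "Y = Metric_space.mtopology M d"
    using Y unfolding metrizable_space_def by blast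
  then interpret Metric_space M d by simp
  have f_cont: "continuous_map X mtopology f"
    using f unfolding embedding_map_def Yd
    by (meson continuous_map_in_subtopology homeomorphic_imp_continuous_map)
  have "\<exists>\<rho> :: 'x \<Rightarrow> nat \<times> 'y. (\<forall>i. openin X {x \<in> topspace X. \<rho> x = i}) \<and>
      (\<forall>x\<in>topspace X. \<forall>y\<in>topspace X. \<rho> x = \<rho> y \<longrightarrow> d (f x) (f y) < 1 / real (Suc k)) \<and>
      (\<forall>y\<in>M. \<exists>N. openin mtopology N \<and> y \<in> N \<and> finite (\<rho> ` {x \<in> topspace X. f x \<in> N}))" for k
  proof -
    have "0 < 1 / real (Suc k)" by simp
    then obtain \<rho> :: "'x \<Rightarrow> nat \<times> 'y" where
      "\<And>i. openin X {x \<in> topspace X. \<rho> x = i}"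
      "\<And>x y. x \<in> topspace X \<Longrightarrow> y \<in> topspace X \<Longrightarrow> \<rho> x = \<rho> y \<Longrightarrow> d (f x) (f y) < 1 / real (Suc k)"
      "\<And>y. y \<in> M \<Longrightarrow> \<exists>N. openin mtopology N \<and> y \<in> N \<and> finite (\<rho> ` {x \<in> topspace X. f x \<in> N})"
      by (rule small_labelling[OF X f_cont]) blast
    then show ?thesis by (intro exI[of _ \<rho>] conjI allI ballI impI) simp_all
  qed
  then have "\<exists>\<pi> :: nat \<Rightarrow> 'x \<Rightarrow> nat \<times> 'y. \<forall>k. (\<forall>i. openin X {x \<in> topspace X. \<pi> k x = i}) \<and>
      (\<forall>x\<in>topspace X. \<forall>y\<in>topspace X. \<pi> k x = \<pi> k y \<longrightarrow> d (f x) (f y) < 1 / real (Suc k)) \<and>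
      (\<forall>y\<in>M. \<exists>N. openin mtopology N \<and> y \<in> N \<and> finite (\<pi> k ` {x \<in> topspace X. f x \<in> N}))"
    by (intro choice allI)
  then obtain \<pi> :: "nat \<Rightarrow> 'x \<Rightarrow> nat \<times> 'y" where
    \<pi>: "\<And>k i. openin X {x \<in> topspace X. \<pi> k x = i}"
      "\<And>k x y. x \<in> topspace X \<Longrightarrow> y \<in> topspace X \<Longrightarrow> \<pi> k x = \<pi> k y \<Longrightarrow> d (f x) (f y) < 1 / real (Suc k)"
      "\<And>k y. y \<in> M \<Longrightarrow> \<exists>N. openin mtopology N \<and> y \<in> N \<and> finite (\<pi> k ` {x \<in> topspace X. f x \<in> N})"
    by blast
  have "labelling X Y f \<pi>"
  proof
    show "\<exists>k. \<forall>y\<in>topspace X. \<pi> k y = \<pi> k x \<longrightarrow> y \<in> U" if U: "openin X U" "x \<in> U" for U x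
    proof -
      have hom: "homeomorphic_map X (subtopology mtopology (f ` topspace X)) f"
        using f unfolding embedding_map_def Yd .
      have UX: "U \<subseteq> topspace X" using U(1) by (rule openin_subset)
      have "openin (subtopology mtopology (f ` topspace X)) (f ` U)"
        using homeomorphic_map_openness_eq[OF hom] U(1) by blast
      then obtain V where V: "openin mtopology V" "f ` U = V \<inter> f ` topspace X"
        unfolding openin_subtopology by blast
      have "f x \<in> V" using V(2) U(2) by blast
      then obtain s where s: "0 < s" "mball (f x) s \<subseteq> V" using V(1) unfolding openin_mtopology by blast
      obtain k where k: "1 / real (Suc k) < s" using nat_approx_posE[OF s(1)] by blast
      have "y \<in> U" if y: "y \<in> topspace X" "\<pi> k y = \<pi> k x" for y
      proof -
        have xX: "x \<in> topspace X" using U(2) UX by blast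
        then have "d (f x) (f y) < s" using \<pi>(2)[of x y k] y k by auto
        moreover have "f x \<in> M" "f y \<in> M" using xX y(1) f_cont by (auto simp: continuous_map_def)
        ultimately have "f y \<in> f ` U" using s(2) V(2) y(1) by auto
        then show "y \<in> U"
          using homeomorphic_imp_injective_map[OF hom] y(1) UX by (metis inj_on_image_mem_iff)
      qed
      then show ?thesis by blast
    qed
  qed (use \<pi> Y f Yd in auto)
  then show ?thesis by (rule that)
qed

section \<open>Convergence in \<open>X\<close> and in \<open>Y\<close> in terms of labels\<close>

context labelling
begin

definition labels :: "'x \<Rightarrow> nat \<Rightarrow> 'i" where
  "labels x = (\<lambda>k. \<pi> k x)"

lemma continuous_f: "continuous_map X Y f"
  using embedding unfolding embedding_map_def
  by (meson continuous_map_in_subtopology homeomorphic_imp_continuous_map)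

lemma f_in: "x \<in> topspace X \<Longrightarrow> f x \<in> topspace Y"
  using continuous_map_image_subset_topspace[OF continuous_f] by blast

lemma Hausdorff_X: "Hausdorff_space X"
proof -
  have "X homeomorphic_space subtopology Y (f ` topspace X)"
    using embedding by (rule embedding_map_imp_homeomorphic_space)
  then have "metrizable_space X"
    using homeomorphic_metrizable_space metrizable_space_subtopology[OF metrizable] by blast
  then show ?thesis by (rule metrizable_imp_Hausdorff_space)
qed

lemma Hausdorff_Y: "Hausdorff_space Y"
  using metrizable by (rule metrizable_imp_Hausdorff_space)

lemma openin_image_trace:
  assumes "openin X U"
  obtains V where "openin Y V" "f ` U = V \<inter> f ` topspace X"
proof -
  have "openin (subtopology Y (f ` topspace X)) (f ` U)"
    using embedding assms homeomorphic_map_openness_eq unfolding embedding_map_def by blast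
  then show ?thesis using that unfolding openin_subtopology by blast
qed

lemma inj_f: "inj_on f (topspace X)"
  using embedding homeomorphic_imp_injective_map unfolding embedding_map_def by blast

lemma inj_labels: "inj_on labels (topspace X)"
proof (rule inj_onI, rule ccontr)
  fix x y assume xy: "x \<in> topspace X" "y \<in> topspace X" "labels x = labels y" "x \<noteq> y"
  then obtain U V where UV: "openin X U" "x \<in> U" "y \<in> V" "disjnt U V"
    using Hausdorff_X unfolding Hausdorff_space_def by meson
  obtain k where "\<forall>z\<in>topspace X. \<pi> k z = \<pi> k x \<longrightarrow> z \<in> U"
    using label_base[OF UV(1,2)] by blast
  moreover have "\<pi> k y = \<pi> k x" using xy(3) unfolding labels_def by metis
  ultimately have "y \<in> U" using xy(2) by blast
  then show False using UV(3,4) unfolding disjnt_iff by blast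
qed

text \<open>\<open>labels\<close> induces the topology of \<open>X\<close>: sets with a fixed label
  are open, and every neighbourhood of a point contains one of those around it.\<close>

lemma limitin_iff_labels:
  assumes x: "range x \<subseteq> topspace X" and z: "z \<in> topspace X"
  shows "limitin X x z sequentially \<longleftrightarrow> (\<forall>k. \<forall>\<^sub>F j in sequentially. \<pi> k (x j) = labels z k)"
proof safe
  fix k assume "limitin X x z sequentially"
  then have "\<forall>\<^sub>F j in sequentially. x j \<in> {y \<in> topspace X. \<pi> k y = \<pi> k z}"
    using label_open z unfolding limitin_def by blast
  then show "\<forall>\<^sub>F j in sequentially. \<pi> k (x j) = labels z k"
    unfolding labels_def by eventually_elim simp
next
  assume *: "\<forall>k. \<forall>\<^sub>F j in sequentially. \<pi> k (x j) = labels z k"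
  show "limitin X x z sequentially"
    unfolding limitin_def
  proof (intro conjI allI impI z)
    fix U assume "openin X U \<and> z \<in> U"
    then obtain k where k: "\<forall>y\<in>topspace X. \<pi> k y = \<pi> k z \<longrightarrow> y \<in> U" using label_base by blast
    have "x j \<in> topspace X" for j using x by blast
    then show "\<forall>\<^sub>F j in sequentially. x j \<in> U"
      using *[rule_format, of k] k unfolding labels_def by (auto elim: eventually_mono)
  qed
qed

text \<open>The closure of \<open>labels ` topspace X\<close> in the Baire space is proper over the closure of \<open>X\<close> in \<open>Y\<close>.\<close>

lemma labels_convergent_subsequence:
  assumes x: "range x \<subseteq> topspace X" and lim: "limitin Y (f \<circ> x) y sequentially"
  obtains \<rho> p where "strict_mono \<rho>" "\<And>k. \<forall>\<^sub>F j in sequentially. \<pi> k (x (\<rho> j)) = p k"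
proof -
  \<comment> \<open>\<open>P k s\<close> says that the \<open>k\<close>-th labels become constant
    along \<open>s\<close>. It survives passing to subsequences, as the diagonal argument
    requires.\<close>
  define P where "P k s \<longleftrightarrow> (\<exists>i. \<forall>\<^sub>F j in sequentially. \<pi> k (x (s j)) = i)" for k and s :: "nat \<Rightarrow> nat"
  interpret subseqs P
  proof
    fix k and s :: "nat \<Rightarrow> nat" assume s: "strict_mono s"
    have y: "y \<in> topspace Y" using lim unfolding limitin_def by blast
    obtain N where N: "openin Y N" "y \<in> N" "finite (\<pi> k ` {x \<in> topspace X. f x \<in> N})"
      using label_finite[OF y] by blast
    have "limitin Y ((f \<circ> x) \<circ> s) y sequentially" using limitin_subsequence[OF s lim] .
    then have "\<forall>\<^sub>F j in sequentially. f (x (s j)) \<in> N"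
      using N unfolding limitin_def by auto
    then obtain J where J: "\<And>j. J \<le> j \<Longrightarrow> f (x (s j)) \<in> N" unfolding eventually_sequentially by blast
    let ?g = "\<lambda>j. \<pi> k (x (s j))"
    have "?g ` {J..} \<subseteq> \<pi> k ` {x \<in> topspace X. f x \<in> N}" using J x by blast
    then have "finite (?g ` {J..})" using N(3) finite_subset by blast
    moreover have "\<not> finite {J..}" by (simp add: infinite_Ici)
    \<comment> \<open>Near \<open>y\<close> only finitely many labels of level \<open>k\<close>
      occur, so one of them occurs infinitely often.\<close>
    ultimately obtain j0 where inf: "infinite {j \<in> {J..}. ?g j = ?g j0}"
      using pigeonhole_infinite[of "{J..}" ?g] by blast
    obtain r' :: "nat \<Rightarrow> nat" where r': "strict_mono r'" "\<forall>n. r' n \<in> {j \<in> {J..}. ?g j = ?g j0}"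
      using infinite_enumerate[OF inf] by blast
    then have "\<forall>j. \<pi> k (x ((s \<circ> r') j)) = ?g j0" by simp
    then have "P k (s \<circ> r')" unfolding P_def by (intro exI[of _ "?g j0"] always_eventually)
    then show "\<exists>r'. strict_mono r' \<and> P k (s \<circ> r')" using r'(1) by blast
  qed
  \<comment> \<open>Only from index \<open>Suc k\<close> on is the diagonal sequence known to be a
    subsequence of the \<open>k\<close>-th stage; the shift is removed below, as it does not affect
    eventual behaviour.\<close>
  have P_diag: "P k (diagseq \<circ> (+) (Suc k))" for k
  proof (rule diagseq_holds)
    fix \<rho> s :: "nat \<Rightarrow> nat" and n assume \<rho>: "strict_mono \<rho>" and "P n s"
    then obtain i where "\<forall>\<^sub>F j in sequentially. \<pi> n (x (s j)) = i" unfolding P_def by blast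
    then have "\<forall>\<^sub>F j in sequentially. \<pi> n (x (s (\<rho> j))) = i" by (rule eventually_subseq[OF \<rho>])
    then show "P n (s \<circ> \<rho>)" unfolding P_def by auto
  qed
  have "\<exists>i. \<forall>\<^sub>F j in sequentially. \<pi> k (x (diagseq (j + Suc k))) = i" for k
    unfolding add.commute[of _ "Suc k"] using P_diag unfolding P_def comp_def .
  then have "\<exists>i. \<forall>\<^sub>F j in sequentially. \<pi> k (x (diagseq j)) = i" for k
    using eventually_sequentially_seg[THEN iffD1, of "\<lambda>j. \<pi> k (x (diagseq j)) = i" "Suc k" for i] by meson
  then obtain p where "\<And>k. \<forall>\<^sub>F j in sequentially. \<pi> k (x (diagseq j)) = p k" by metis
  then show ?thesis using that subseq_diagseq by blast
qed

text \<open>If the limiting labels are those of a point \<open>z\<close> of \<open>X\<close>, the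
  subsequence converges to \<open>z\<close> in \<open>X\<close>, and limits in \<open>Y\<close> are
  unique.\<close>

lemma limit_eq_if_labels:
  assumes x: "range x \<subseteq> topspace X" and lim: "limitin Y (f \<circ> x) y sequentially" and \<rho>: "strict_mono \<rho>"
    and p: "\<And>k. \<forall>\<^sub>F j in sequentially. \<pi> k (x (\<rho> j)) = labels z k" and z: "z \<in> topspace X"
  shows "y = f z"
proof -
  have "limitin X (x \<circ> \<rho>) z sequentially"
    using p x z by (subst limitin_iff_labels) auto
  then have "limitin Y (f \<circ> (x \<circ> \<rho>)) (f z) sequentially"
    using continuous_map_limit[OF continuous_f] by blast
  moreover have "limitin Y (f \<circ> x \<circ> \<rho>) y sequentially" using limitin_subsequence[OF \<rho> lim] .
  ultimately show ?thesis
    using limitin_Hausdorff_unique[of Y "f \<circ> x \<circ> \<rho>" y sequentially "f z"] Hausdorff_Y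
    by (simp add: comp_assoc)
qed

end

section \<open>Passage from the Baire space to \<open>Y\<close>\<close>

locale scaled_labelling = labelling X Y f \<pi> + null_scale r
  for X :: "'x topology" and Y :: "'y topology" and f :: "'x \<Rightarrow> 'y" and \<pi> :: "nat \<Rightarrow> 'x \<Rightarrow> 'i"
    and r :: "nat \<Rightarrow> real"
begin

lemma closedin_Y_iff:
  "closedin Y S \<longleftrightarrow> S \<subseteq> topspace Y \<and>
    (\<forall>\<sigma> l. range \<sigma> \<subseteq> S \<and> limitin Y \<sigma> l sequentially \<longrightarrow> l \<in> S)"
proof -
  obtain M d where "Metric_space M d" and Yd: "Y = Metric_space.mtopology M d"
    using metrizable unfolding metrizable_space_def by blast
  then interpret Metric_space M d by simp
  show ?thesis unfolding Yd using metric_closedin_iff_sequentially_closed by simp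
qed

lemma image_sequence:
  assumes "range \<sigma> \<subseteq> f ` F"
  obtains x where "range x \<subseteq> F" "\<sigma> = f \<circ> x"
proof -
  have "\<forall>n. \<exists>x. x \<in> F \<and> \<sigma> n = f x" using assms by blast
  then obtain x where "\<And>n. x n \<in> F \<and> \<sigma> n = f (x n)" by metis
  then have "range x \<subseteq> F" "\<sigma> = f \<circ> x" by auto
  then show ?thesis by (rule that)
qed

text \<open>A sequence in the image that converges to \<open>y\<close> in \<open>Y\<close> has a
  subsequence whose labels converge to some \<open>p\<close> in \<open>C\<close>. As
  \<open>C\<close> consists of labels of points, \<open>p\<close> comes from a point of
  \<open>X\<close>, whose image must be \<open>y\<close>.\<close>

lemma closedin_image_of_closed_labels:
  assumes C: "closedin baire_topology C" "C \<subseteq> labels ` topspace X"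
  shows "closedin Y (f ` {x \<in> topspace X. labels x \<in> C})"
  unfolding closedin_Y_iff
proof (intro conjI allI impI)
  let ?F = "{x \<in> topspace X. labels x \<in> C}"
  show "f ` ?F \<subseteq> topspace Y" using f_in by blast
  fix \<sigma> y assume *: "range \<sigma> \<subseteq> f ` ?F \<and> limitin Y \<sigma> y sequentially"
  then obtain x where x: "range x \<subseteq> ?F" "\<sigma> = f \<circ> x" using image_sequence by meson
  have lim: "limitin Y (f \<circ> x) y sequentially" and xX: "range x \<subseteq> topspace X" using * x by auto
  obtain \<rho> p where \<rho>: "strict_mono \<rho>" and p: "\<And>k. \<forall>\<^sub>F j in sequentially. \<pi> k (x (\<rho> j)) = p k"
    using labels_convergent_subsequence[OF xX lim] by blast
  have "limitin baire_topology (\<lambda>j. labels (x (\<rho> j))) p sequentially"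
    unfolding limitin_baire_topology using p by (simp add: labels_def)
  then have "p \<in> C"
  proof (rule limitin_closedin[OF _ C(1)])
    show "\<forall>\<^sub>F j in sequentially. labels (x (\<rho> j)) \<in> C" using x(1) by (intro always_eventually) blast
  qed simp
  then obtain z where z: "z \<in> topspace X" "p = labels z" using C(2) by blast
  then have "y = f z" using limit_eq_if_labels[OF xX lim \<rho> _ z(1)] p by simp
  then show "y \<in> f ` ?F" using z \<open>p \<in> C\<close> by blast
qed

text \<open>\<open>q\<close> is a limit of labels along a sequence in \<open>X\<close> that
  converges in \<open>Y\<close> to a point off the image. If \<open>q\<close> were the labels of a
  point of \<open>X\<close>, that limit would be in the image.\<close>

lemma ex_new_labels:
  assumes "\<not> closedin Y (f ` topspace X)"
  obtains q where "q \<notin> labels ` topspace X" "\<And>n. \<exists>x\<in>topspace X. \<forall>k\<le>n. labels x k = q k"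
proof -
  have "f ` topspace X \<subseteq> topspace Y" using f_in by blast
  then obtain \<sigma> y where \<sigma>: "range \<sigma> \<subseteq> f ` topspace X" "limitin Y \<sigma> y sequentially" "y \<notin> f ` topspace X"
    using assms unfolding closedin_Y_iff by blast
  obtain x where x: "range x \<subseteq> topspace X" "\<sigma> = f \<circ> x" using image_sequence[OF \<sigma>(1)] by blast
  have lim: "limitin Y (f \<circ> x) y sequentially" using \<sigma>(2) x(2) by simp
  obtain \<rho> q where \<rho>: "strict_mono \<rho>" and q: "\<And>k. \<forall>\<^sub>F j in sequentially. \<pi> k (x (\<rho> j)) = q k"
    using labels_convergent_subsequence[OF x(1) lim] by blast
  show ?thesis
  proof
    show "q \<notin> labels ` topspace X"
      using limit_eq_if_labels[OF x(1) lim \<rho>] q \<sigma>(3) by blast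
    fix n
    have "\<forall>\<^sub>F j in sequentially. \<forall>k\<in>{..n}. \<pi> k (x (\<rho> j)) = q k"
      using q by (intro eventually_ball_finite) auto
    then obtain j where "\<forall>k\<in>{..n}. \<pi> k (x (\<rho> j)) = q k"
      unfolding eventually_sequentially by blast
    then show "\<exists>x\<in>topspace X. \<forall>k\<le>n. labels x k = q k"
      using x(1) by (intro bexI[of _ "x (\<rho> j)"]) (auto simp: labels_def)
  qed
qed

text \<open>As in Lavrentiev's theorem, \<open>labels\<close> extends to a continuous map
  \<open>\<sigma>\<close> on a G-delta set \<open>S\<close> in the closure of the image, and the
  image of \<open>X\<close> is exactly the preimage of its labels. From \<open>n = 2\<close> on the
  G-delta set is absorbed.\<close>

lemma additive_class_image:
  assumes A: "labels ` topspace X \<in> additive_class baire_topology n" and n: "n \<ge> 2"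
  shows "f ` topspace X \<in> additive_class Y n"
proof -
  let ?K = "Y closure_of (f ` topspace X)"
  \<comment> \<open>\<open>O' k\<close> consists of the points with a neighbourhood on which the
    \<open>k\<close>-th label of points of \<open>X\<close> is constant; on \<open>S\<close> all
    labels extend.\<close>
  define O' where "O' k = \<Union>{N. openin Y N \<and> (\<exists>i. \<forall>x\<in>topspace X. f x \<in> N \<longrightarrow> \<pi> k x = i)}" for k
  define S where "S = ?K \<inter> (\<Inter>k. O' k)"
  have "openin Y (O' k)" for k unfolding O'_def by (rule openin_Union) blast
  then have "gdelta_in Y (\<Inter>(range O'))" by (intro gdelta_in_Inter) (auto intro: open_imp_gdelta_in)
  then have S: "gdelta_in Y S"
    unfolding S_def using closed_imp_gdelta_in[OF metrizable closedin_closure_of] by (intro gdelta_in_Int)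
  have "\<exists>i. \<exists>N. openin Y N \<and> y \<in> N \<and> (\<forall>x\<in>topspace X. f x \<in> N \<longrightarrow> \<pi> k x = i)" if "y \<in> S" for y k
    using that unfolding S_def O'_def by blast
  then obtain \<sigma> where \<sigma>:
    "\<And>y k. y \<in> S \<Longrightarrow> \<exists>N. openin Y N \<and> y \<in> N \<and> (\<forall>x\<in>topspace X. f x \<in> N \<longrightarrow> \<pi> k x = \<sigma> y k)"
    by metis
  have SK: "S \<subseteq> ?K" and SY: "S \<subseteq> topspace Y"
    unfolding S_def using closure_of_subset_topspace[of Y] by blast+
  \<comment> \<open>Neighbourhoods of points of \<open>S\<close> meet \<open>X\<close>. This makes
    \<open>\<sigma>\<close> locally constant in each coordinate: two overlapping neighbourhoods
    share a point of \<open>X\<close> and hence its label.\<close>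
  have hit: "\<exists>x\<in>topspace X. f x \<in> N" if "openin Y N" "y \<in> N" "y \<in> S" for N y
    using that SK unfolding closure_of_def by blast
  have loc: "\<exists>N. openin Y N \<and> y \<in> N \<and> (\<forall>y'\<in>N \<inter> S. \<sigma> y' k = \<sigma> y k)" if y: "y \<in> S" for y k
  proof -
    obtain N where N: "openin Y N" "y \<in> N" "\<forall>x\<in>topspace X. f x \<in> N \<longrightarrow> \<pi> k x = \<sigma> y k"
      using \<sigma>[OF y] by blast
    have "\<sigma> y' k = \<sigma> y k" if y': "y' \<in> N" "y' \<in> S" for y'
    proof -
      obtain N' where N': "openin Y N'" "y' \<in> N'" "\<forall>x\<in>topspace X. f x \<in> N' \<longrightarrow> \<pi> k x = \<sigma> y' k"
        using \<sigma>[OF y'(2)] by blast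
      then obtain x where "x \<in> topspace X" "f x \<in> N \<inter> N'"
        using hit[of "N \<inter> N'" y'] N(1) y' by blast
      then show ?thesis using N(3) N'(3) by force
    qed
    then show ?thesis using N(1,2) by blast
  qed
  have cont: "continuous_map (subtopology Y S) baire_topology \<sigma>"
    unfolding continuous_map_def
  proof (intro conjI allI impI)
    fix U :: "(nat \<Rightarrow> 'i) set" assume U: "openin baire_topology U"
    let ?P = "{y \<in> topspace (subtopology Y S). \<sigma> y \<in> U}"
    have "\<exists>W. openin (subtopology Y S) W \<and> y \<in> W \<and> W \<subseteq> ?P" if "y \<in> ?P" for y
    proof -
      have y: "y \<in> S" "\<sigma> y \<in> U" using that by auto
      obtain m where m: "\<And>t. \<forall>k\<le>m. \<sigma> y k = t k \<Longrightarrow> t \<in> U"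
        using U y(2) unfolding openin_baire_topology by blast
      obtain N where N: "\<And>k. openin Y (N k)" "\<And>k. y \<in> N k" "\<And>k. \<forall>y'\<in>N k \<inter> S. \<sigma> y' k = \<sigma> y k"
        using loc[OF y(1)] by metis
      let ?W = "(\<Inter>k\<in>{..m}. N k) \<inter> S"
      have "openin Y (\<Inter>k\<in>{..m}. N k)" using N(1) by (intro openin_Inter) auto
      then have "openin (subtopology Y S) ?W" by (rule openin_subtopology_Int)
      moreover have "?W \<subseteq> ?P"
      proof
        fix y' assume y': "y' \<in> ?W"
        then have "\<forall>k\<le>m. \<sigma> y k = \<sigma> y' k" using N(3) by (metis IntI Int_iff INT_E atMost_iff)
        then show "y' \<in> ?P" using m y' SY by auto
      qed
      ultimately show ?thesis using N(2) y(1) by blast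
    qed
    then show "openin (subtopology Y S) ?P" by (subst openin_subopen) blast
  qed simp
  have fS: "f x \<in> S" if x: "x \<in> topspace X" for x
  proof -
    have "f x \<in> O' k" for k
    proof -
      obtain V where V: "openin Y V" "f ` {y \<in> topspace X. \<pi> k y = \<pi> k x} = V \<inter> f ` topspace X"
        using openin_image_trace[OF label_open] by blast
      have "\<pi> k z = \<pi> k x" if "z \<in> topspace X" "f z \<in> V" for z
      proof -
        have "f z \<in> f ` {y \<in> topspace X. \<pi> k y = \<pi> k x}" using V(2) that by blast
        then show ?thesis using inj_f that(1) by (auto dest: inj_onD)
      qed
      moreover have "f x \<in> V" using V(2) x by blast
      ultimately show ?thesis unfolding O'_def using V(1) by blast
    qed
    moreover have "f x \<in> ?K" using x f_in closure_of_subset[of "f ` topspace X" Y] by blast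
    ultimately show ?thesis unfolding S_def by blast
  qed
  have \<sigma>f: "\<sigma> (f x) = labels x" if x: "x \<in> topspace X" for x
    using \<sigma>[OF fS[OF x]] x unfolding labels_def by (intro ext) metis
  \<comment> \<open>If \<open>\<sigma> y\<close> were the labels of some \<open>x\<close> with
    \<open>f x \<noteq> y\<close>, points of \<open>X\<close> near \<open>y\<close> would share a
    label with \<open>x\<close> and so map into a neighbourhood of \<open>f x\<close> that is
    disjoint from one of \<open>y\<close>.\<close>
  have only: "y \<in> f ` topspace X" if y: "y \<in> S" and lab: "\<sigma> y \<in> labels ` topspace X" for y
  proof (rule ccontr)
    assume y_notin: "y \<notin> f ` topspace X"
    obtain x where x: "x \<in> topspace X" "\<sigma> y = labels x" using lab by blast
    have "y \<noteq> f x" using y_notin x(1) by blast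
    moreover have "y \<in> topspace Y" "f x \<in> topspace Y" using y SY f_in x(1) by auto
    ultimately obtain V W where VW: "openin Y V" "openin Y W" "y \<in> V" "f x \<in> W" "disjnt V W"
      using Hausdorff_Y unfolding Hausdorff_space_def by metis
    have "openin X {z \<in> topspace X. f z \<in> W}"
      using continuous_f VW(2) by (rule openin_continuous_map_preimage)
    moreover have "x \<in> {z \<in> topspace X. f z \<in> W}" using x(1) VW(4) by simp
    ultimately obtain k where k: "\<forall>z\<in>topspace X. \<pi> k z = \<pi> k x \<longrightarrow> f z \<in> W"
      using label_base[of "{z \<in> topspace X. f z \<in> W}" x] by blast
    obtain N where N: "openin Y N" "y \<in> N" "\<forall>x\<in>topspace X. f x \<in> N \<longrightarrow> \<pi> k x = \<sigma> y k"
      using \<sigma>[OF y, of k] by blast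
    obtain z where z: "z \<in> topspace X" "f z \<in> V \<inter> N"
      using hit[of "V \<inter> N" y] VW N y by blast
    then have "\<pi> k z = \<pi> k x" using N(3) x(2) unfolding labels_def by auto
    then show False using k z VW(5) unfolding disjnt_iff by blast
  qed
  have "{y \<in> topspace (subtopology Y S). \<sigma> y \<in> labels ` topspace X} = f ` topspace X"
    using only fS \<sigma>f SY by auto
  then have "f ` topspace X \<in> additive_class (subtopology Y S) n"
    using Borel_class_vimage[OF cont, of n] A by metis
  then show ?thesis using additive_class_gdelta_subspace[OF metrizable S _ n] by blast
qed

text \<open>A G-delta domain cannot be absorbed at level 1, so the closed pieces of the labels are
  carried to \<open>Y\<close> one by one and remain closed there.\<close>

lemma additive_class_image_1:
  assumes A: "labels ` topspace X \<in> additive_class baire_topology 1"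
  shows "f ` topspace X \<in> additive_class Y 1"
proof -
  obtain \<C> where C: "labels ` topspace X = \<Union>\<C>" "countable \<C>" "\<And>C. C \<in> \<C> \<Longrightarrow> closedin baire_topology C"
  proof -
    obtain \<C> where "labels ` topspace X = \<Union>\<C>" "countable \<C>"
      "\<C> \<subseteq> (\<Union>m\<in>{..<Suc 0}. multiplicative_class baire_topology m)"
      using A unfolding One_nat_def additive_class.simps mem_Collect_eq by metis
    then show thesis using that[of \<C>] by (auto split: if_splits)
  qed
  let ?g = "\<lambda>C. f ` {x \<in> topspace X. labels x \<in> C}"
  have "?g C \<in> multiplicative_class Y 0" if "C \<in> \<C>" for C
    using closedin_image_of_closed_labels[OF C(3)] that C(1) by auto
  then have "?g ` \<C> \<subseteq> (\<Union>m\<in>{..<Suc 0}. multiplicative_class Y m)" by auto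
  moreover have "countable (?g ` \<C>)" using C(2) by simp
  moreover have "f ` topspace X = \<Union>(?g ` \<C>)"
  proof -
    have "\<exists>C\<in>\<C>. labels x \<in> C" if "x \<in> topspace X" for x
      using imageI[OF that, of labels] unfolding C(1) by blast
    then show ?thesis by fast
  qed
  ultimately show ?thesis unfolding One_nat_def additive_class.simps by blast
qed

end

section \<open>Gluing two points of the Baire space\<close>

context scaled_labelling
begin

text \<open>This is the distance from \<open>labels x\<close> to the glued point.\<close>

definition glue_height :: "(nat \<Rightarrow> 'i) \<Rightarrow> (nat \<Rightarrow> 'i) \<Rightarrow> 'x \<Rightarrow> real" where
  "glue_height q p x = min (baire_dist (labels x) p) (baire_dist (labels x) q)"

text \<open>The quotient pseudo-ultrametric of the Baire space that identifies \<open>p\<close> with \<open>q\<close>, pulled back to \<open>X\<close>.\<close>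

definition glue :: "(nat \<Rightarrow> 'i) \<Rightarrow> (nat \<Rightarrow> 'i) \<Rightarrow> 'x \<Rightarrow> 'x \<Rightarrow> real" where
  "glue q p x y = (if x \<in> topspace X \<and> y \<in> topspace X
     then min (baire_dist (labels x) (labels y)) (max (glue_height q p x) (glue_height q p y))
     else 0)"

lemma glue_height_nonneg: "0 \<le> glue_height q p x"
  unfolding glue_height_def by (simp add: baire_dist_nonneg)

lemma glue_height_le: "glue_height q p x \<le> max (glue_height q p y) (baire_dist (labels x) (labels y))"
  using baire_dist_ultra[of "labels x" p "labels y"] baire_dist_ultra[of "labels x" q "labels y"]
  unfolding glue_height_def by linarith

text \<open>This estimate makes \<open>glue q\<close> 1-Lipschitz in \<open>p\<close>, hence
  continuous.\<close>

lemma glue_height_perturb: "glue_height q p x \<le> max (glue_height q p' x) (baire_dist p p')"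
  using baire_dist_ultra[of "labels x" p p'] baire_dist_sym[of p p']
  unfolding glue_height_def by linarith

lemma glue_nonneg: "0 \<le> glue q p x y"
  unfolding glue_def by (simp add: baire_dist_nonneg glue_height_nonneg le_max_iff_disj)

lemma glue_sym: "glue q p x y = glue q p y x"
  unfolding glue_def using baire_dist_sym[of "labels x" "labels y"] by (simp add: max.commute)

text \<open>In the mixed case one leg is a Baire distance and the other passes through the glued
  point; \<open>glue_height_le\<close> carries the height of \<open>z\<close> along the first
  leg.\<close>

lemma glue_ultra:
  assumes "x \<in> topspace X" "y \<in> topspace X" "z \<in> topspace X"
  shows "glue q p x y \<le> max (glue q p x z) (glue q p z y)"
  using assms baire_dist_ultra[of "labels x" "labels y" "labels z"]
    glue_height_le[of q p x z] glue_height_le[of q p y z] baire_dist_sym[of "labels z" "labels y"]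
  unfolding glue_def by (simp split del: if_split) linarith

lemma pseudo_ultrametric_glue: "pseudo_ultrametric_on (topspace X) (glue q p)"
  unfolding pseudo_ultrametric_on_def
proof (intro conjI ballI allI impI)
  show "glue q p x x = 0" if "x \<in> topspace X" for x
    using that by (simp add: glue_def baire_dist_def glue_height_nonneg min_absorb1)
  show "glue q p x y = 0" if "x \<notin> topspace X \<or> y \<notin> topspace X" for x y
    using that by (auto simp: glue_def)
qed (auto intro: glue_nonneg glue_sym glue_ultra)

text \<open>\<open>min\<close> and \<open>max\<close> only select among Baire distances, so gluing
  creates no value outside the scale.\<close>

lemma glue_in: "glue q p x y \<in> insert 0 (range r)"
  using baire_dist_in[of "labels x" "labels y"] baire_dist_in[of "labels x" p] baire_dist_in[of "labels x" q]
    baire_dist_in[of "labels y" p] baire_dist_in[of "labels y" q]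
  unfolding glue_def glue_height_def by (simp add: min_def max_def split del: if_split split: if_split)

lemma glue_le: "glue q p x y \<le> r 0"
  using baire_dist_le[of "labels x" "labels y"] r_pos[of 0] unfolding glue_def by auto

lemma equal_above_glue: "equal_above (baire_dist p p') (glue q p) (glue q p')"
proof -
  have le: "glue q p x y \<le> max (glue q p' x y) (baire_dist p p')" for p p' x y
  proof (cases "x \<in> topspace X \<and> y \<in> topspace X")
    case True
    then have eq: "glue q p x y =
        min (baire_dist (labels x) (labels y)) (max (glue_height q p x) (glue_height q p y))" for p
      by (simp add: glue_def)
    show ?thesis
      using glue_height_perturb[of q p x p'] glue_height_perturb[of q p y p'] unfolding eq by linarith
  next
    case False
    then have "glue q p x y = 0" by (auto simp: glue_def)
    then show ?thesis using glue_nonneg[of q p' x y] by (simp add: le_max_iff_disj)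
  qed
  have "glue q p' x y \<le> max (glue q p x y) (baire_dist p p')" for x y
    using le[of p' x y p] baire_dist_sym[of p p'] by simp
  then show ?thesis unfolding equal_above_def using le by blast
qed

lemma continuous_glue: "continuous_map baire_topology uniform_topology (glue q)"
  unfolding Metric_space.metric_continuous_map[OF Metric_space_baire_dist Metric_space_uniform_dist]
proof (intro conjI ballI allI impI)
  show "range (glue q) \<subseteq> nonneg_maps" using glue_nonneg unfolding nonneg_maps_def by blast
  fix p :: "nat \<Rightarrow> 'i" and \<epsilon> :: real assume \<epsilon>: "0 < \<epsilon>"
  have "uniform_dist (glue q p) (glue q p') \<le> baire_dist p p'" for p'
    using equal_above_glue baire_dist_nonneg by (intro uniform_dist_le) auto
  then show "\<exists>\<delta>>0. \<forall>p'. p' \<in> UNIV \<and> baire_dist p p' < \<delta> \<longrightarrow> uniform_dist (glue q p) (glue q p') < \<epsilon>"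
    using \<epsilon> le_less_trans by blast
qed

text \<open>Every point of \<open>X\<close> has positive height, and at distances below that height
  \<open>glue\<close> coincides with the Baire distance of the labels.\<close>

lemma mtopology_glue:
  assumes p: "p \<notin> labels ` topspace X" and q: "q \<notin> labels ` topspace X"
  shows "ultrametric_on (topspace X) (glue q p)"
    and "Metric_space.mtopology (topspace X) (glue q p) = X"
proof -
  have pos: "0 < glue_height q p x" if "x \<in> topspace X" for x
  proof -
    have "baire_dist (labels x) p \<noteq> 0" "baire_dist (labels x) q \<noteq> 0" using p q that by auto
    then have "0 < baire_dist (labels x) p" "0 < baire_dist (labels x) q"
      using baire_dist_nonneg order_less_le by metis+
    then show ?thesis unfolding glue_height_def by simp
  qed
  have near: "glue q p x y = baire_dist (labels x) (labels y)"
    if "x \<in> topspace X" "y \<in> topspace X" "glue q p x y < glue_height q p x" for x y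
    using that unfolding glue_def by (auto simp: min_def max_def split: if_splits)
  show ultra: "ultrametric_on (topspace X) (glue q p)"
    unfolding ultrametric_on_def
  proof (intro conjI ballI impI pseudo_ultrametric_glue)
    fix x y assume xy: "x \<in> topspace X" "y \<in> topspace X" "glue q p x y = 0"
    then have "labels x = labels y" using near[OF xy(1,2)] pos[OF xy(1)] by simp
    then show "x = y" using inj_labels xy by (auto dest: inj_onD)
  qed
  interpret Metric_space "topspace X" "glue q p" using ultra by (rule ultrametric_on_imp_Metric_space)
  have "openin mtopology U \<longleftrightarrow> openin X U" for U
  proof
    assume U: "openin X U"
    have "\<exists>s>0. mball x s \<subseteq> U" if x: "x \<in> U" for x
    proof -
      have xX: "x \<in> topspace X" using x openin_subset[OF U] by blast
      obtain k where k: "\<forall>y\<in>topspace X. \<pi> k y = \<pi> k x \<longrightarrow> y \<in> U" using label_base[OF U x] by blast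
      have "mball x (min (r k) (glue_height q p x)) \<subseteq> U"
      proof
        fix y assume "y \<in> mball x (min (r k) (glue_height q p x))"
        then have y: "y \<in> topspace X" "glue q p x y < r k" "glue q p x y < glue_height q p x" by auto
        then have "baire_dist (labels x) (labels y) < r k" using near[OF xX] by simp
        then have "\<pi> k y = \<pi> k x" unfolding baire_dist_less_iff labels_def by simp
        then show "y \<in> U" using k y(1) by blast
      qed
      then show ?thesis using r_pos[of k] pos[OF xX] by (intro exI[of _ "min (r k) (glue_height q p x)"]) simp
    qed
    then show "openin mtopology U" unfolding openin_mtopology using openin_subset[OF U] by blast
  next
    assume U: "openin mtopology U"
    have "\<exists>W. openin X W \<and> x \<in> W \<and> W \<subseteq> U" if x: "x \<in> U" for x
    proof -
      have UX: "U \<subseteq> topspace X" using U unfolding openin_mtopology by blast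
      then have xX: "x \<in> topspace X" using x by blast
      obtain s where s: "0 < s" "mball x s \<subseteq> U" using U x unfolding openin_mtopology by blast
      obtain n where n: "r n < s" using r_null[OF s(1)] by blast
      let ?W = "\<Inter>k\<in>{..n}. {y \<in> topspace X. \<pi> k y = \<pi> k x}"
      have "openin X ?W" using label_open by (intro openin_Inter) auto
      moreover have "x \<in> ?W" using xX by simp
      moreover have "?W \<subseteq> U"
      proof
        fix y assume y: "y \<in> ?W"
        then have yX: "y \<in> topspace X" by blast
        have "baire_dist (labels x) (labels y) < r n"
          using y unfolding baire_dist_less_iff labels_def by simp
        then have "glue q p x y < s" using n unfolding glue_def by (simp add: xX yX min_less_iff_disj)
        then show "y \<in> U" using s(2) xX yX by auto
      qed
      ultimately show ?thesis by blast
    qed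
    then show "openin X U" by (subst openin_subopen) blast
  qed
  then show "mtopology = X" unfolding topology_eq by blast
qed

text \<open>Here \<open>x\<close> sits at the glued point, so points of \<open>X\<close> with labels
  close to \<open>q\<close> become close to \<open>x\<close>, although they differ from
  \<open>x\<close> in a fixed label.\<close>

lemma mtopology_glue_neq:
  assumes x: "x \<in> topspace X" and q: "q \<notin> labels ` topspace X"
    and dense: "\<And>n. \<exists>y\<in>topspace X. \<forall>k\<le>n. labels y k = q k"
    and ultra: "ultrametric_on (topspace X) (glue q (labels x))"
  shows "Metric_space.mtopology (topspace X) (glue q (labels x)) \<noteq> X"
proof
  interpret Metric_space "topspace X" "glue q (labels x)"
    using ultra by (rule ultrametric_on_imp_Metric_space)
  assume eq: "mtopology = X"
  have "labels x \<noteq> q" using x q by blast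
  then obtain k where k: "\<pi> k x \<noteq> q k" unfolding labels_def by auto
  have "openin mtopology {y \<in> topspace X. \<pi> k y = \<pi> k x}" unfolding eq by (rule label_open)
  then obtain s where s: "0 < s" "mball x s \<subseteq> {y \<in> topspace X. \<pi> k y = \<pi> k x}"
    using x unfolding openin_mtopology by blast
  obtain n where n: "r n < s" using r_null[OF s(1)] by blast
  \<comment> \<open>Agreement with \<open>q\<close> up to \<open>n\<close> makes \<open>y\<close>
    close to \<open>x\<close>, and agreement at \<open>k\<close> gives it a label other than that of
    \<open>x\<close>.\<close>
  obtain y where y: "y \<in> topspace X" "\<forall>j\<le>max n k. labels y j = q j" using dense by blast
  then have "baire_dist (labels y) q < r n" unfolding baire_dist_less_iff by simp
  then have "glue q (labels x) x y < s"
    using n s(1) baire_dist_eq_0_iff[of "labels x" "labels x"] baire_dist_nonneg[of "labels x" q] x y(1)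
    unfolding glue_def glue_height_def by (simp del: baire_dist_eq_0_iff)
  then have "\<pi> k y = \<pi> k x" using s(2) x y(1) by auto
  then show False using k y(2) unfolding labels_def by auto
qed

lemma glue_in_UMet_bd_iff:
  assumes R: "range_set R" "range r \<subseteq> R" and q: "q \<notin> labels ` topspace X"
    and dense: "\<And>n. \<exists>y\<in>topspace X. \<forall>k\<le>n. labels y k = q k"
  shows "glue q p \<in> UMet_bd X R \<longleftrightarrow> p \<notin> labels ` topspace X"
proof
  assume "glue q p \<in> UMet_bd X R"
  then show "p \<notin> labels ` topspace X"
    using mtopology_glue_neq[OF _ q dense] unfolding UMet_bd_def by blast
next
  assume p: "p \<notin> labels ` topspace X"
  have "glue q p x y \<in> R" for x y
    using glue_in[of q p x y] R unfolding range_set_def by auto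
  then show "glue q p \<in> UMet_bd X R"
    unfolding UMet_bd_def using mtopology_glue[OF p q] glue_le by blast
qed

text \<open>That the image is not closed supplies the point \<open>q\<close> to glue with; taking
  complements then exchanges the multiplicative for the additive class.\<close>

lemma additive_class_labels:
  assumes R: "range_set R" "range r \<subseteq> R" 
    and M: "UMet_bd X R \<in> multiplicative_class uniform_topology n"
    and Y: "\<not> closedin Y (f ` topspace X)"
  shows "labels ` topspace X \<in> additive_class baire_topology n"
proof -
  obtain q where q: "q \<notin> labels ` topspace X" "\<And>n. \<exists>x\<in>topspace X. \<forall>k\<le>n. labels x k = q k"
    using ex_new_labels[OF Y] by blast
  have "{p \<in> topspace baire_topology. glue q p \<in> UMet_bd X R} \<in> multiplicative_class baire_topology n"
    using Borel_class_vimage[OF continuous_glue, of n] M by blast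
  then have "- labels ` topspace X \<in> multiplicative_class baire_topology n"
    using glue_in_UMet_bd_iff[OF R q] by (simp add: Compl_eq)
  then have "topspace baire_topology - (- labels ` topspace X) \<in> additive_class baire_topology n"
    using Borel_class_complement by blast
  then show ?thesis by (simp add: Compl_eq_Diff_UNIV[symmetric])
qed

end

section \<open>From the class of the space of ultrametrics to that of \<open>X\<close>\<close>

theorem theorem5p1:
  fixes R :: "real set" and X :: "'a topology" and n :: nat
  assumes "range_set R" and "characteristic R"
    and "ultrametrizable_space X"
    and "n \<ge> 1"
    and "absolute_multiplicative TYPE(nat \<Rightarrow> 'a \<Rightarrow> 'a \<Rightarrow> real) n (UMet_bd_space X R)"
  shows "absolute_additive TYPE('y) n X"
  unfolding absolute_additive_def
proof (intro conjI allI impI)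
  show "metrizable_space X"
    using assms(3) ultrametric_on_imp_Metric_space
    unfolding ultrametrizable_space_def metrizable_space_def by metis
  fix Y :: "'y topology" and f assume "metrizable_space Y \<and> embedding_map X Y f"
  then have Y: "metrizable_space Y" and f: "embedding_map X Y f" by auto
  show "f ` topspace X \<in> additive_class Y n"
  proof (cases "closedin Y (f ` topspace X)")
    case True
    then show ?thesis using assms(4) by (rule closedin_imp_additive_class)
  next
    case False
    obtain \<pi> :: "nat \<Rightarrow> 'a \<Rightarrow> nat \<times> 'y" where "labelling X Y f \<pi>"
      using ex_labelling[OF assms(3) Y f] .
    moreover obtain r where "null_scale r" and r: "range r \<subseteq> R"
      using null_scale_in_characteristic[OF assms(1,2)] .
    ultimately interpret scaled_labelling X Y f \<pi> r by (simp add: scaled_labelling_def)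
    have "UMet_bd X R \<in> multiplicative_class uniform_topology n"
      using assms(1,2,5) by (rule UMet_bd_multiplicative_class)
    then have "labels ` topspace X \<in> additive_class baire_topology n"
      using additive_class_labels[OF assms(1) r _ False] by blast
    then show ?thesis
      using additive_class_image additive_class_image_1 assms(4)
      by (cases "n = 1") auto
  qed
qed

end
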